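(* Let $G$ be a finitely generated 2-nilpotent torsion-free group, let $R$ be a binomial domain of characteristic zero, let $G\otimes R$ be the tensor $R$-completion of $G$ in the class $\mathcal{N}_{2,R}$, let $G\otimes_{\mathcal H}R$ be the Hall $R$-completion of $G$, and let $\mu: G\otimes R\to G\otimes_{\mathcal H}R$ be the canonical $R$-epimorphism. Let $u_1,\dots,u_m\in G$ be elements whose images form a basis of the free abelian group $G/Z(G)$, let $v_1,\dots,v_n$ be a basis of the free abelian group $Z(G)$, and let $$H_{\bar u\cdot\bar v}=\{u_1^{\alpha_1}\cdots u_m^{\alpha_m}v_1^{\beta_1}\cdots v_n^{\beta_n}\mid \alpha_i,\beta_j\in R\}\subseteq G\otimes R,$$ which is a subgroup of $G\otimes R$. Then: 1) The restriction of $\mu$ to $H_{\bar u\cdot\bar v}$ is an isomorphism of abstract groups from $H_{\bar u\cdot\bar v}$ onto $G\otimes_{\mathcal H}R$. In particular, $G\otimes_{\mathcal H}R$ embeds in $G\otimes R$ as an abstract group, and $\mu$ is a retraction onto $G\otimes_{\mathcal H}R$, viewed as the subgroup $H_{\bar u\cdot\bar v}$ of $G\otimes R$. 2) The kernel $D=\ker\mu$ is an abelian $R$-subgroup of $G\otimes R$, generated as an $R$-group by all c-commutators $c(g,h)_\alpha$ with $g,h\in G\otimes R$, $\alpha\in R$. 3) $G\otimes R\simeq (G\otimes_{\mathcal H}R)\times D$ as a direct product of abstract groups.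
   Context: **Binomial domain.** An integral domain $R$ of characteristic zero such that for all $\alpha\in R$ and $i\ge 1$ the element $\binom{\alpha}{i}=\frac{\alpha(\alpha-1)\cdots(\alpha-i+1)}{i!}$ of the field of fractions of $R$ lies in $R$. **$R$-groups.** Write $[g,h]=g^{-1}h^{-1}gh$. An $R$-group is a group $G$ with a map $G\times R\to G$, $(g,\alpha)\mapsto g^\alpha$, such that for all $x,y\in G$, $\alpha,\beta\in R$: (1) $x^1=x$, $x^0=e$, $e^\alpha=e$; (2) $x^\alpha x^\beta=x^{\alpha+\beta}$, $(x^\alpha)^\beta=x^{\alpha\beta}$; (3) $(y^{-1}xy)^\alpha=y^{-1}x^\alpha y$; (4) if $[x,y]=e$ then $(xy)^\alpha=x^\alpha y^\alpha$. An $R$-homomorphism is a group homomorphism commuting with all maps $g\mapsto g^\alpha$. An $R$-subgroup is a subgroup closed under all these maps. The $R$-subgroup generated by a set is the smallest $R$-subgroup containing it. An "abstract group" is a group considered without its $R$-exponentiation. **2-nilpotent.** A group is 2-nilpotent if it satisfies $[[x,y],z]=e$. $\mathcal N_{2,R}$ is the class of all 2-nilpotent $R$-groups. $\mathcal H_{2,R}$ (Hall $R$-groups of class at most 2) is the class of those groups in $\mathcal N_{2,R}$ in which $(xy)^\alpha=x^\alpha y^\alpha[x,y]^{-\binom{\alpha}{2}}$ for all $x,y$ and all $\alpha\in R$. **Tensor completion.** For a torsion-free 2-nilpotent group $G$, the tensor $R$-completion $G\otimes R=G\otimes_{\mathcal N_{2,R}}R$ is the $R$-group in $\mathcal N_{2,R}$,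 with a homomorphism $\lambda:G\to G\otimes R$, such that $\lambda(G)$ $R$-generates $G\otimes R$ and every homomorphism $\varphi$ from $G$ to a group $H\in\mathcal N_{2,R}$ has the form $\varphi=\psi\circ\lambda$ for an $R$-homomorphism $\psi:G\otimes R\to H$. It is known that it exists, is unique up to $R$-isomorphism, and that $\lambda$ is injective; $G$ is identified with $\lambda(G)$. **Hall completion.** $G\otimes_{\mathcal H}R$ is the analogous completion in the class $\mathcal H_{2,R}$. Concretely (P. Hall), for $G$ finitely generated torsion-free 2-nilpotent with $u_i,v_j$ as in the claim, let $[u_i,u_j]=\bar v^{\bar k(i,j)}$ with $\bar k(i,j)\in\mathbb Z^n$. Then $G\otimes_{\mathcal H}R$ is the set of formal products $\bar u^{\bar\alpha}\bar v^{\bar\beta}=u_1^{\alpha_1}\cdots u_m^{\alpha_m}v_1^{\beta_1}\cdots v_n^{\beta_n}$ ($\bar\alpha\in R^m$, $\bar\beta\in R^n$), distinct tuples giving distinct elements, with $$\bar u^{\bar\alpha}\bar v^{\bar\beta}\cdot\bar u^{\bar\gamma}\bar v^{\bar\delta}=\bar u^{\bar\alpha+\bar\gamma}\,\bar v^{\bar\beta+\bar\delta+\sum_{i>j}\alpha_i\gamma_j\bar k(i,j)},\qquad (\bar u^{\bar\alpha}\bar v^{\bar\beta})^\lambda=\bar u^{\lambda\bar\alpha}\,\bar v^{\lambda\bar\beta+\binom{\lambda}{2}\sum_{i>j}\alpha_i\alpha_j\bar k(i,j)}.$$ **Canonical epimorphism.** $\mu:G\otimes R\to G\otimes_{\mathcal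 H}R$ is the $R$-homomorphism that extends the inclusion $G\to G\otimes_{\mathcal H}R$; it is surjective. **c-commutators.** In a 2-nilpotent $R$-group, for elements $g,h$ and $\alpha\in R$, put $(g,h)_\alpha=h^{-\alpha}g^{-\alpha}(gh)^\alpha$ and $c(g,h)_\alpha=[g,h]^{\binom{\alpha}{2}}(g,h)_\alpha$. *)

theory Defs
  imports
    "HOL-Algebra.Generated_Groups"
    "HOL-Algebra.FiniteProduct"
    "HOL-Computational_Algebra.Polynomial_Factorial"
begin

section \<open>Binomial domains\<close>

text \<open>
  The ground ring is a type of class \<open>{idom, ring_char_0}\<close>. The binomial coefficients of
  its elements are computed in the field of fractions with the library's \<^const>\<open>gbinomial\<close>;
  this needs the field of fractions to be known to have characteristic zero.
\<close>

instance fract :: ("{idom, ring_char_0}") field_char_0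
proof
  show "inj (of_nat :: nat \<Rightarrow> 'a fract)"
    by (rule injI) (simp add: of_nat_fract eq_fract)
qed

definition binomial_domain :: "'r :: {idom, ring_char_0} itself \<Rightarrow> bool" where
  "binomial_domain _ \<longleftrightarrow>
     (\<forall>(\<alpha>::'r) i. i \<ge> 1 \<longrightarrow> to_fract \<alpha> gchoose i \<in> range (to_fract :: 'r \<Rightarrow> 'r fract))"

text \<open>The binomial coefficient as an element of the domain itself (\<^const>\<open>to_fract\<close> is injective).\<close>

definition rbinom :: "'r :: {idom, ring_char_0} \<Rightarrow> nat \<Rightarrow> 'r" where
  "rbinom \<alpha> i = (THE b. to_fract b = to_fract \<alpha> gchoose i)"

lemma to_fract_rbinom:
  fixes \<alpha> :: "'r :: {idom, ring_char_0}"
  assumes "binomial_domain TYPE('r)"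
  shows "to_fract (rbinom \<alpha> i) = to_fract \<alpha> gchoose i"
proof -
  obtain b :: 'r where b: "to_fract b = to_fract \<alpha> gchoose i"
  proof (cases "i = 0")
    case True
    then show ?thesis using that[of 1] by simp
  next
    case False
    then have "to_fract \<alpha> gchoose i \<in> range (to_fract :: 'r \<Rightarrow> 'r fract)"
      using assms unfolding binomial_domain_def by auto
    then show ?thesis using that by fastforce
  qed
  show ?thesis
    unfolding rbinom_def
  proof (rule theI[of _ b])
    show "x = b" if "to_fract x = to_fract \<alpha> gchoose i" for x
      using trans[OF that b[symmetric]] unfolding to_fract_eq_iff .
  qed (rule b)
qed


section \<open>Groups with exponents\<close>

record ('a, 'r) rgroup = "'a monoid" +
  rpow :: "'a \<Rightarrow> 'r \<Rightarrow> 'a" (infixl \<open>\<up>\<index>\<close> 75)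

text \<open>Convention: $[g,h] = g^{-1}h^{-1}gh$.\<close>

definition commutator :: "('a, 'b) monoid_scheme \<Rightarrow> 'a \<Rightarrow> 'a \<Rightarrow> 'a" where
  "commutator G g h = inv\<^bsub>G\<^esub> g \<otimes>\<^bsub>G\<^esub> inv\<^bsub>G\<^esub> h \<otimes>\<^bsub>G\<^esub> g \<otimes>\<^bsub>G\<^esub> h"

locale r_group = group G
  for G :: "('a, 'r :: {idom, ring_char_0}) rgroup" (structure) +
  assumes rpow_closed: "x \<in> carrier G \<Longrightarrow> x \<up> \<alpha> \<in> carrier G"
    and rpow_1: "x \<in> carrier G \<Longrightarrow> x \<up> 1 = x"
    and rpow_0: "x \<in> carrier G \<Longrightarrow> x \<up> 0 = \<one>"
    and one_rpow: "\<one> \<up> \<alpha> = \<one>"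
    and rpow_add: "x \<in> carrier G \<Longrightarrow> x \<up> \<alpha> \<otimes> x \<up> \<beta> = x \<up> (\<alpha> + \<beta>)"
    and rpow_rpow: "x \<in> carrier G \<Longrightarrow> (x \<up> \<alpha>) \<up> \<beta> = x \<up> (\<alpha> * \<beta>)"
    and rpow_conj: "x \<in> carrier G \<Longrightarrow> y \<in> carrier G \<Longrightarrow>
      (inv y \<otimes> x \<otimes> y) \<up> \<alpha> = inv y \<otimes> x \<up> \<alpha> \<otimes> y"
    and rpow_mult: "x \<in> carrier G \<Longrightarrow> y \<in> carrier G \<Longrightarrow> commutator G x y = \<one> \<Longrightarrow>
      (x \<otimes> y) \<up> \<alpha> = x \<up> \<alpha> \<otimes> y \<up> \<alpha>"

definition r_hom :: "('a, 'r) rgroup \<Rightarrow> ('b, 'r) rgroup \<Rightarrow> ('a \<Rightarrow> 'b) set" where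
  "r_hom G H = {h \<in> hom G H. \<forall>x \<in> carrier G. \<forall>\<alpha>. h (x \<up>\<^bsub>G\<^esub> \<alpha>) = h x \<up>\<^bsub>H\<^esub> \<alpha>}"

definition r_subgroup :: "'a set \<Rightarrow> ('a, 'r) rgroup \<Rightarrow> bool" where
  "r_subgroup K G \<longleftrightarrow> subgroup K G \<and> (\<forall>x \<in> K. \<forall>\<alpha>. x \<up>\<^bsub>G\<^esub> \<alpha> \<in> K)"

definition r_generate :: "('a, 'r) rgroup \<Rightarrow> 'a set \<Rightarrow> 'a set" where
  "r_generate G S = \<Inter>{K. r_subgroup K G \<and> S \<subseteq> K}"

definition two_nilpotent :: "('a, 'b) monoid_scheme \<Rightarrow> bool" where
  "two_nilpotent G \<longleftrightarrow> (\<forall>x \<in> carrier G. \<forall>y \<in> carrier G. \<forall>z \<in> carrier G.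
     commutator G (commutator G x y) z = \<one>\<^bsub>G\<^esub>)"

definition N2 :: "('a, 'r :: {idom, ring_char_0}) rgroup \<Rightarrow> bool" where
  "N2 G \<longleftrightarrow> r_group G \<and> two_nilpotent G"

definition H2 :: "('a, 'r :: {idom, ring_char_0}) rgroup \<Rightarrow> bool" where
  "H2 G \<longleftrightarrow> N2 G \<and> (\<forall>x \<in> carrier G. \<forall>y \<in> carrier G. \<forall>\<alpha>.
     (x \<otimes>\<^bsub>G\<^esub> y) \<up>\<^bsub>G\<^esub> \<alpha>
       = x \<up>\<^bsub>G\<^esub> \<alpha> \<otimes>\<^bsub>G\<^esub> y \<up>\<^bsub>G\<^esub> \<alpha> \<otimes>\<^bsub>G\<^esub> commutator G x y \<up>\<^bsub>G\<^esub> (- rbinom \<alpha> 2))"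

definition c_commutator :: "('a, 'r :: {idom, ring_char_0}) rgroup \<Rightarrow> 'a \<Rightarrow> 'a \<Rightarrow> 'r \<Rightarrow> 'a" where
  "c_commutator G g h \<alpha> = commutator G g h \<up>\<^bsub>G\<^esub> rbinom \<alpha> 2 \<otimes>\<^bsub>G\<^esub>
     (h \<up>\<^bsub>G\<^esub> (- \<alpha>) \<otimes>\<^bsub>G\<^esub> g \<up>\<^bsub>G\<^esub> (- \<alpha>) \<otimes>\<^bsub>G\<^esub> (g \<otimes>\<^bsub>G\<^esub> h) \<up>\<^bsub>G\<^esub> \<alpha>)"


section \<open>Completions\<close>

text \<open>
  The universal property of a completion of \<open>G\<close> quantifies over all groups \<open>H\<close> in a class.
  HOL cannot quantify over the carrier types of these \<open>H\<close> inside a formula, so they are taken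
  on the type of formal \<open>'r\<close>-group expressions in the elements of \<open>G\<close>. This is no restriction:
  the \<open>R\<close>-subgroup generated by the image of \<open>G\<close> in any \<open>H\<close> consists of values of such
  expressions, hence has an isomorphic copy carried by a set of expressions. The lemmas
  \<open>tensor_completion_universal\<close> and \<open>hall_completion_universal\<close> below derive the universal
  property for groups \<open>H\<close> on arbitrary types.
\<close>

datatype ('g, 'r) rterm =
    Gen 'g
  | One
  | Mult "('g, 'r) rterm" "('g, 'r) rterm"
  | Inv "('g, 'r) rterm"
  | Pow "('g, 'r) rterm" 'r

definition universal_on ::
    "(('h, 'r) rgroup \<Rightarrow> bool) \<Rightarrow> 'g monoid \<Rightarrow> ('p, 'r) rgroup \<Rightarrow> ('g \<Rightarrow> 'p) \<Rightarrow> bool" where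
  "universal_on \<C> G P \<iota> \<longleftrightarrow>
     (\<forall>H \<phi>. \<C> H \<and> \<phi> \<in> hom G H \<longrightarrow>
        (\<exists>\<psi> \<in> r_hom P H. \<forall>g \<in> carrier G. \<phi> g = \<psi> (\<iota> g)))"

definition tensor_completion ::
    "'g monoid \<Rightarrow> ('p, 'r :: {idom, ring_char_0}) rgroup \<Rightarrow> ('g \<Rightarrow> 'p) \<Rightarrow> bool" where
  "tensor_completion G P \<iota> \<longleftrightarrow>
     N2 P \<and> \<iota> \<in> hom G P \<and> r_generate P (\<iota> ` carrier G) = carrier P \<and>
     universal_on (N2 :: (('g, 'r) rterm, 'r) rgroup \<Rightarrow> bool) G P \<iota>"

definition hall_completion ::
    "'g monoid \<Rightarrow> ('p, 'r :: {idom, ring_char_0}) rgroup \<Rightarrow> ('g \<Rightarrow> 'p) \<Rightarrow> bool" where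
  "hall_completion G P \<iota> \<longleftrightarrow>
     H2 P \<and> \<iota> \<in> hom G P \<and> r_generate P (\<iota> ` carrier G) = carrier P \<and>
     universal_on (H2 :: (('g, 'r) rterm, 'r) rgroup \<Rightarrow> bool) G P \<iota>"

primrec rterm_eval :: "('h, 'r) rgroup \<Rightarrow> ('g \<Rightarrow> 'h) \<Rightarrow> ('g, 'r) rterm \<Rightarrow> 'h" where
  "rterm_eval H \<phi> (Gen g) = \<phi> g"
| "rterm_eval H \<phi> One = \<one>\<^bsub>H\<^esub>"
| "rterm_eval H \<phi> (Mult s t) = rterm_eval H \<phi> s \<otimes>\<^bsub>H\<^esub> rterm_eval H \<phi> t"
| "rterm_eval H \<phi> (Inv t) = inv\<^bsub>H\<^esub> rterm_eval H \<phi> t"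
| "rterm_eval H \<phi> (Pow t \<alpha>) = rterm_eval H \<phi> t \<up>\<^bsub>H\<^esub> \<alpha>"

lemma (in r_group) r_subgroup_carrier: "r_subgroup (carrier G) G"
  unfolding r_subgroup_def using subgroup_self rpow_closed by auto

lemma (in r_group) r_subgroup_r_generate:
  assumes "S \<subseteq> carrier G"
  shows "r_subgroup (r_generate G S) G"
proof -
  have "subgroup (r_generate G S) G"
    unfolding r_generate_def
    by (rule subgroups_Inter) (use assms r_subgroup_carrier in \<open>auto simp: r_subgroup_def\<close>)
  then show ?thesis
    unfolding r_subgroup_def r_generate_def by auto
qed

lemma r_generate_incl: "S \<subseteq> r_generate G S"
  unfolding r_generate_def by auto

lemma (in r_group) r_generate_subset_eval:
  assumes "\<phi> ` A \<subseteq> carrier G"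
  shows "r_generate G (\<phi> ` A) \<subseteq> range (rterm_eval G \<phi>)"
proof -
  let ?V = "carrier G \<inter> range (rterm_eval G \<phi>)"
  have "subgroup ?V G"
  proof (rule subgroupI)
    show "?V \<noteq> {}"
      using one_closed rangeI[of "rterm_eval G \<phi>" One] by auto
    show "inv a \<in> ?V" if a: "a \<in> ?V" for a
    proof -
      obtain t where "a = rterm_eval G \<phi> t" using a by auto
      then show ?thesis using a rangeI[of "rterm_eval G \<phi>" "Inv t"] by auto
    qed
    show "a \<otimes> b \<in> ?V" if ab: "a \<in> ?V" "b \<in> ?V" for a b
    proof -
      obtain s t where "a = rterm_eval G \<phi> s" "b = rterm_eval G \<phi> t" using ab by auto
      then show ?thesis using ab rangeI[of "rterm_eval G \<phi>" "Mult s t"] by auto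
    qed
  qed auto
  moreover have "a \<up> \<alpha> \<in> ?V" if a: "a \<in> ?V" for a \<alpha>
  proof -
    obtain t where "a = rterm_eval G \<phi> t" using a by auto
    then show ?thesis using a rpow_closed rangeI[of "rterm_eval G \<phi>" "Pow t \<alpha>"] by auto
  qed
  moreover have "\<phi> ` A \<subseteq> ?V"
  proof
    fix x assume "x \<in> \<phi> ` A"
    then obtain g where "x = rterm_eval G \<phi> (Gen g)" by auto
    then show "x \<in> ?V" using \<open>x \<in> \<phi> ` A\<close> assms by blast
  qed
  ultimately have "r_generate G (\<phi> ` A) \<subseteq> ?V"
    unfolding r_generate_def r_subgroup_def by blast
  then show ?thesis by blast
qed

text \<open>Transport of an \<open>R\<close>-subgroup along an injection into another type.\<close>

definition transport :: "('h, 'r) rgroup \<Rightarrow> 'h set \<Rightarrow> ('h \<Rightarrow> 'k) \<Rightarrow> ('k, 'r) rgroup" where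
  "transport H K f =
     \<lparr> carrier = f ` K,
       monoid.mult = (\<lambda>x y. f (inv_into K f x \<otimes>\<^bsub>H\<^esub> inv_into K f y)),
       one = f \<one>\<^bsub>H\<^esub>,
       rpow = (\<lambda>x \<alpha>. f (inv_into K f x \<up>\<^bsub>H\<^esub> \<alpha>)) \<rparr>"

context
  fixes H :: "('h, 'r :: {idom, ring_char_0}) rgroup" and K :: "'h set" and f :: "'h \<Rightarrow> 'k"
  assumes H: "r_group H" and K: "r_subgroup K H" and f: "inj_on f K"
begin

interpretation H: r_group H by (rule H)

lemma
  shows K_carrier: "x \<in> K \<Longrightarrow> x \<in> carrier H"
    and K_mult: "x \<in> K \<Longrightarrow> y \<in> K \<Longrightarrow> x \<otimes>\<^bsub>H\<^esub> y \<in> K"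
    and K_one: "\<one>\<^bsub>H\<^esub> \<in> K"
    and K_inv: "x \<in> K \<Longrightarrow> inv\<^bsub>H\<^esub> x \<in> K"
    and K_rpow: "x \<in> K \<Longrightarrow> x \<up>\<^bsub>H\<^esub> \<alpha> \<in> K"
  using K unfolding r_subgroup_def
  by (auto intro: subgroup.mem_carrier subgroup.m_closed subgroup.one_closed
      subgroup.m_inv_closed)

lemma K_commutator: "x \<in> K \<Longrightarrow> y \<in> K \<Longrightarrow> commutator H x y \<in> K"
  unfolding commutator_def by (intro K_mult K_inv)

lemmas K_closed = K_carrier K_mult K_one K_inv K_rpow K_commutator

lemma transport_simps:
  "carrier (transport H K f) = f ` K"
  "\<one>\<^bsub>transport H K f\<^esub> = f \<one>\<^bsub>H\<^esub>"
  "x \<in> K \<Longrightarrow> y \<in> K \<Longrightarrow> f x \<otimes>\<^bsub>transport H K f\<^esub> f y = f (x \<otimes>\<^bsub>H\<^esub> y)"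
  "x \<in> K \<Longrightarrow> f x \<up>\<^bsub>transport H K f\<^esub> \<alpha> = f (x \<up>\<^bsub>H\<^esub> \<alpha>)"
  using f by (auto simp: transport_def)

lemma transport_group: "group (transport H K f)"
proof (rule groupI)
  show "\<exists>y \<in> carrier (transport H K f). y \<otimes>\<^bsub>transport H K f\<^esub> x = \<one>\<^bsub>transport H K f\<^esub>"
    if x: "x \<in> carrier (transport H K f)" for x
  proof -
    obtain a where "x = f a" "a \<in> K" using x by (auto simp: transport_simps)
    then show ?thesis
      by (intro bexI[of _ "f (inv\<^bsub>H\<^esub> a)"])
        (simp_all add: transport_simps K_closed)
  qed
qed (auto simp: transport_simps K_closed H.m_assoc)

lemma transport_inv: "x \<in> K \<Longrightarrow> inv\<^bsub>transport H K f\<^esub> (f x) = f (inv\<^bsub>H\<^esub> x)"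
  by (rule group.inv_equality[OF transport_group]) (auto simp: transport_simps K_closed)

lemma transport_commutator:
  "x \<in> K \<Longrightarrow> y \<in> K \<Longrightarrow> commutator (transport H K f) (f x) (f y) = f (commutator H x y)"
  unfolding commutator_def by (simp add: transport_simps transport_inv K_closed)

lemma transport_r_group: "r_group (transport H K f)"
proof (intro r_group.intro r_group_axioms.intro)
  fix x y and \<alpha> :: 'r
  assume "x \<in> carrier (transport H K f)" "y \<in> carrier (transport H K f)"
    and c: "commutator (transport H K f) x y = \<one>\<^bsub>transport H K f\<^esub>"
  then obtain a b where ab: "x = f a" "y = f b" "a \<in> K" "b \<in> K"
    by (auto simp: transport_simps)
  then have "commutator H a b = \<one>\<^bsub>H\<^esub>"
    using c f by (auto simp: transport_simps transport_commutator K_closed dest: inj_onD)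
  then show "(x \<otimes>\<^bsub>transport H K f\<^esub> y) \<up>\<^bsub>transport H K f\<^esub> \<alpha> =
      x \<up>\<^bsub>transport H K f\<^esub> \<alpha> \<otimes>\<^bsub>transport H K f\<^esub> y \<up>\<^bsub>transport H K f\<^esub> \<alpha>"
    using ab H.rpow_mult by (simp add: transport_simps K_closed)
qed (auto simp: transport_simps transport_inv K_closed transport_group H.rpow_1 H.rpow_0
      H.one_rpow H.rpow_add H.rpow_rpow H.rpow_conj)

lemma transport_N2: "N2 H \<Longrightarrow> N2 (transport H K f)"
  using transport_r_group
  by (auto simp: N2_def two_nilpotent_def transport_simps transport_commutator K_closed)

lemma transport_H2: "H2 H \<Longrightarrow> H2 (transport H K f)"
  using transport_N2
  by (auto simp: H2_def transport_simps transport_commutator K_closed)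

end

lemma universal_on_any_type:
  fixes G :: "'g monoid" and P :: "('p, 'r :: {idom, ring_char_0}) rgroup"
    and H :: "('h, 'r) rgroup" and \<C> :: "(('g, 'r) rterm, 'r) rgroup \<Rightarrow> bool"
  assumes u: "universal_on \<C> G P \<iota>" and H: "r_group H" and \<phi>: "\<phi> \<in> hom G H"
    and \<C>: "\<And>K (f :: 'h \<Rightarrow> ('g, 'r) rterm). r_subgroup K H \<Longrightarrow> inj_on f K \<Longrightarrow> \<C> (transport H K f)"
    and P: "r_group P"
  shows "\<exists>\<psi> \<in> r_hom P H. \<forall>g \<in> carrier G. \<phi> g = \<psi> (\<iota> g)"
proof -
  interpret H: r_group H by (rule H)
  interpret P: r_group P by (rule P)
  define K where "K = r_generate H (\<phi> ` carrier G)"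
  define f where "f = inv_into UNIV (rterm_eval H \<phi>)"
  have im: "\<phi> ` carrier G \<subseteq> carrier H" using \<phi> by (auto simp: hom_def)
  have K: "r_subgroup K H" unfolding K_def by (rule H.r_subgroup_r_generate[OF im])
  have "K \<subseteq> range (rterm_eval H \<phi>)"
    unfolding K_def by (rule H.r_generate_subset_eval[OF im])
  then have f: "inj_on f K"
    unfolding f_def by (rule inj_on_inv_into)
  note ts = transport_simps[OF H K f] and cl = K_closed[OF H K f]
  have \<phi>K: "\<phi> g \<in> K" if "g \<in> carrier G" for g
    unfolding K_def by (rule subsetD[OF r_generate_incl imageI[OF that]])
  have \<phi>': "(\<lambda>g. f (\<phi> g)) \<in> hom G (transport H K f)"
    using \<phi> \<phi>K by (auto simp: hom_def ts)
  have "\<exists>\<psi> \<in> r_hom P (transport H K f). \<forall>g \<in> carrier G. f (\<phi> g) = \<psi> (\<iota> g)"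
    by (rule u[unfolded universal_on_def, THEN spec, THEN spec, THEN mp,
          OF conjI, OF \<C>[OF K f] \<phi>'])
  then obtain \<psi> where \<psi>: "\<psi> \<in> r_hom P (transport H K f)"
    and \<psi>_ext: "\<forall>g \<in> carrier G. f (\<phi> g) = \<psi> (\<iota> g)"
    by (rule bexE)
  have \<psi>_mult: "\<psi> (x \<otimes>\<^bsub>P\<^esub> y) = \<psi> x \<otimes>\<^bsub>transport H K f\<^esub> \<psi> y"
    if "x \<in> carrier P" "y \<in> carrier P" for x y
    using \<psi> that by (simp add: r_hom_def hom_def)
  have \<psi>_rpow: "\<psi> (x \<up>\<^bsub>P\<^esub> \<alpha>) = \<psi> x \<up>\<^bsub>transport H K f\<^esub> \<alpha>" if "x \<in> carrier P" for x \<alpha>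
    using \<psi> that by (simp add: r_hom_def)
  have \<psi>_in: "\<psi> x \<in> f ` K" if "x \<in> carrier P" for x
    using \<psi> that by (auto simp: r_hom_def hom_def ts)
  define \<chi> where "\<chi> = (\<lambda>x. inv_into K f (\<psi> x))"
  have \<chi>K: "\<chi> x \<in> K" if "x \<in> carrier P" for x
    unfolding \<chi>_def by (rule inv_into_into[OF \<psi>_in[OF that]])
  have \<psi>\<chi>: "\<psi> x = f (\<chi> x)" if "x \<in> carrier P" for x
    unfolding \<chi>_def by (rule f_inv_into_f[OF \<psi>_in[OF that], symmetric])
  have \<chi>_eq: "\<chi> x = k" if "\<psi> x = f k" "k \<in> K" for x k
    unfolding \<chi>_def that(1) by (rule inv_into_f_f[OF f that(2)])
  have "\<chi> \<in> r_hom P H"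
    unfolding r_hom_def hom_def mem_Collect_eq
  proof (intro conjI ballI allI)
    show "\<chi> \<in> carrier P \<rightarrow> carrier H"
      by (rule Pi_I) (rule cl(1)[OF \<chi>K])
    fix x assume x: "x \<in> carrier P"
    show "\<chi> (x \<up>\<^bsub>P\<^esub> \<alpha>) = \<chi> x \<up>\<^bsub>H\<^esub> \<alpha>" for \<alpha>
      by (rule \<chi>_eq) (simp_all add: \<psi>_rpow[OF x] \<psi>\<chi>[OF x] ts cl \<chi>K x)
    fix y assume y: "y \<in> carrier P"
    show "\<chi> (x \<otimes>\<^bsub>P\<^esub> y) = \<chi> x \<otimes>\<^bsub>H\<^esub> \<chi> y"
      by (rule \<chi>_eq) (simp_all add: \<psi>_mult[OF x y] \<psi>\<chi>[OF x] \<psi>\<chi>[OF y] ts cl \<chi>K x y)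
  qed
  moreover have "\<phi> g = \<chi> (\<iota> g)" if "g \<in> carrier G" for g
    by (rule \<chi>_eq[symmetric, OF bspec[OF \<psi>_ext that, symmetric] \<phi>K[OF that]])
  ultimately show ?thesis by (intro bexI[of _ \<chi>] ballI)
qed

lemma tensor_completion_universal:
  fixes G :: "'g monoid" and P :: "('p, 'r :: {idom, ring_char_0}) rgroup"
    and H :: "('h, 'r) rgroup"
  assumes "tensor_completion G P \<iota>" "N2 H" "\<phi> \<in> hom G H"
  shows "\<exists>\<psi> \<in> r_hom P H. \<forall>g \<in> carrier G. \<phi> g = \<psi> (\<iota> g)"
proof (rule universal_on_any_type)
  show "universal_on (N2 :: (('g, 'r) rterm, 'r) rgroup \<Rightarrow> bool) G P \<iota>"
    using assms(1) unfolding tensor_completion_def by (elim conjE)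
  show H: "r_group H" using assms(2) by (simp add: N2_def)
  show "r_group P" using assms(1) by (simp add: tensor_completion_def N2_def)
  show "N2 (transport H K f)"
    if "r_subgroup K H" "inj_on f K" for K and f :: "'h \<Rightarrow> ('g, 'r) rterm"
    using transport_N2[OF H that assms(2)] .
qed (rule assms(3))

lemma hall_completion_universal:
  fixes G :: "'g monoid" and P :: "('p, 'r :: {idom, ring_char_0}) rgroup"
    and H :: "('h, 'r) rgroup"
  assumes "hall_completion G P \<iota>" "H2 H" "\<phi> \<in> hom G H"
  shows "\<exists>\<psi> \<in> r_hom P H. \<forall>g \<in> carrier G. \<phi> g = \<psi> (\<iota> g)"
proof (rule universal_on_any_type)
  show "universal_on (H2 :: (('g, 'r) rterm, 'r) rgroup \<Rightarrow> bool) G P \<iota>"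
    using assms(1) unfolding hall_completion_def by (elim conjE)
  show H: "r_group H" using assms(2) by (simp add: H2_def N2_def)
  show "r_group P" using assms(1) by (simp add: hall_completion_def H2_def N2_def)
  show "H2 (transport H K f)"
    if "r_subgroup K H" "inj_on f K" for K and f :: "'h \<Rightarrow> ('g, 'r) rterm"
    using transport_H2[OF H that assms(2)] .
qed (rule assms(3))


section \<open>Bases and ordered products\<close>

definition center :: "('a, 'b) monoid_scheme \<Rightarrow> 'a set" where
  "center G = {z \<in> carrier G. \<forall>g \<in> carrier G. z \<otimes>\<^bsub>G\<^esub> g = g \<otimes>\<^bsub>G\<^esub> z}"

definition finitely_generated :: "('a, 'b) monoid_scheme \<Rightarrow> bool" where
  "finitely_generated G \<longleftrightarrow> (\<exists>S. finite S \<and> S \<subseteq> carrier G \<and> generate G S = carrier G)"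

definition torsion_free :: "('a, 'b) monoid_scheme \<Rightarrow> bool" where
  "torsion_free G \<longleftrightarrow> (\<forall>x \<in> carrier G. \<forall>n::nat. n > 0 \<and> x [^]\<^bsub>G\<^esub> n = \<one>\<^bsub>G\<^esub> \<longrightarrow> x = \<one>\<^bsub>G\<^esub>)"

text \<open>\<open>b 0, \<dots>, b (m - 1)\<close> is a basis of the (multiplicatively written) free abelian group \<open>A\<close>.\<close>

definition abelian_basis :: "('a, 'b) monoid_scheme \<Rightarrow> nat \<Rightarrow> (nat \<Rightarrow> 'a) \<Rightarrow> bool" where
  "abelian_basis A m b \<longleftrightarrow>
     comm_group A \<and> (\<forall>i < m. b i \<in> carrier A) \<and>
     (\<forall>x \<in> carrier A. \<exists>k :: nat \<Rightarrow> int. x = (\<Otimes>\<^bsub>A\<^esub>i \<in> {..<m}. b i [^]\<^bsub>A\<^esub> k i)) \<and>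
     (\<forall>k :: nat \<Rightarrow> int. (\<Otimes>\<^bsub>A\<^esub>i \<in> {..<m}. b i [^]\<^bsub>A\<^esub> k i) = \<one>\<^bsub>A\<^esub> \<longrightarrow> (\<forall>i < m. k i = 0))"

primrec ordered_prod :: "('a, 'b) monoid_scheme \<Rightarrow> (nat \<Rightarrow> 'a) \<Rightarrow> nat \<Rightarrow> 'a" where
  "ordered_prod G x 0 = \<one>\<^bsub>G\<^esub>"
| "ordered_prod G x (Suc m) = ordered_prod G x m \<otimes>\<^bsub>G\<^esub> x m"

text \<open>The set \<open>H\<^bsub>u\<cdot>v\<^esub>\<close>, with \<open>u\<close> and \<open>v\<close> already mapped into the completion \<open>P\<close>.\<close>

definition uv_products ::
    "('p, 'r) rgroup \<Rightarrow> nat \<Rightarrow> (nat \<Rightarrow> 'p) \<Rightarrow> nat \<Rightarrow> (nat \<Rightarrow> 'p) \<Rightarrow> 'p set" where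
  "uv_products P m u n v =
     {ordered_prod P (\<lambda>i. u i \<up>\<^bsub>P\<^esub> \<alpha> i) m \<otimes>\<^bsub>P\<^esub> ordered_prod P (\<lambda>j. v j \<up>\<^bsub>P\<^esub> \<beta> j) n
       | (\<alpha> :: nat \<Rightarrow> 'r) (\<beta> :: nat \<Rightarrow> 'r). True}"

end

theory Submission
  imports Defs
begin

text \<open>
  In a 2-nilpotent $R$-group $[x^\alpha,y]=[x,y]^\alpha$, so the elements
  $\bar u^{\bar\alpha}\bar v^{\bar\beta}$ multiply by Hall's formula both in $G\otimes R$ and in
  $G\otimes_{\mathcal H}R$, and $\mu$ maps one kind to the other. They are pairwise distinct in
  $G\otimes_{\mathcal H}R$, because by its universal property this group maps to the concrete group
  on $R^m\times R^n$ with Hall's operations. The c-commutators are central in $G\otimes R$ (the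
  commutator of $h^{-\alpha}g^{-\alpha}(gh)^\alpha$ with any $z$ is
  $[h,z]^{-\alpha}[g,z]^{-\alpha}[gh,z]^\alpha=1$) and trivial in the Hall
  completion. Modulo the central $R$-subgroup $C$ they generate, $G\otimes R$ satisfies Hall's power
  formula, so $H_{\bar u\cdot\bar v}\,C$ is an $R$-subgroup containing $G$, hence everything. As
  $\mu$ is injective on $H_{\bar u\cdot\bar v}$ and kills $C$, its kernel is exactly $C$.
\<close>

text \<open>The exponent axioms distribute a power over a product only when the factors commute. In
  a tensor completion the power of gh for noncommuting g and h therefore obeys Hall's formula only
  up to an error factor, which is the c-commutator. This is the obstacle: nothing makes the products
  of u-powers and v-powers closed under exponentiation, so they are compared with the Hall
  completion as an abstract group only.

  The group G itself is regarded as a group with integer exponents. Commutators of the u_i computed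
  there give integer constants \<open>k\<close>, and the same constants govern multiplication in G
  and in both completions. That normal forms exhaust the Hall completion is not assumed: it follows
  from the same decomposition as in the tensor completion, where the second factor is now trivial.

  Centrality also gives the direct product. If \<open>\<sigma>\<close> inverts \<open>\<mu>\<close>
  on the subgroup of normal forms, then sending (q, d) to the product of \<open>\<sigma> q\<close>
  and d is multiplicative because d is central, injective because \<open>\<mu>\<close> recovers q,
  and onto by the decomposition.\<close>

section \<open>Ordered products and centers\<close>

lemma ordered_prod_cong:
  "(\<And>i. i < m \<Longrightarrow> x i = y i) \<Longrightarrow> ordered_prod G x m = ordered_prod G y m"
  by (induction m) auto

lemma (in group) ordered_prod_in_subgroup:
  assumes "subgroup K G" "\<And>i. i < m \<Longrightarrow> x i \<in> K"
  shows "ordered_prod G x m \<in> K"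
  using assms(2)
  by (induction m) (auto intro: subgroup.one_closed subgroup.m_closed assms(1))

lemma (in group) ordered_prod_closed:
  "(\<And>i. i < m \<Longrightarrow> x i \<in> carrier G) \<Longrightarrow> ordered_prod G x m \<in> carrier G"
  by (rule ordered_prod_in_subgroup[OF subgroup_self])

lemma (in group) ordered_prod_one: "ordered_prod G (\<lambda>i. \<one>) m = \<one>"
  by (induction m) auto

lemma (in group) ordered_prod_single:
  assumes "i < m" "x \<in> carrier G"
  shows "ordered_prod G (\<lambda>j. if j = i then x else \<one>) m = x"
  using assms(1)
proof (induction m)
  case (Suc m)
  show ?case
  proof (cases "i = m")
    case True
    then have "ordered_prod G (\<lambda>j. if j = i then x else \<one>) m = ordered_prod G (\<lambda>i. \<one>) m"
      by (intro ordered_prod_cong) auto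
    then show ?thesis using True assms(2) by (simp add: ordered_prod_one)
  qed (use Suc assms(2) in auto)
qed simp

lemma (in group_hom) hom_ordered_prod:
  "(\<And>i. i < m \<Longrightarrow> x i \<in> carrier G) \<Longrightarrow>
    h (ordered_prod G x m) = ordered_prod H (\<lambda>i. h (x i)) m"
  by (induction m) (auto simp: G.ordered_prod_closed)

text \<open>Bases are stated with unordered products in abelian groups, whereas normal forms live in
  a nonabelian group. This is the bridge between the two.\<close>

lemma (in comm_group) finprod_eq_ordered_prod:
  assumes "\<And>i. i < m \<Longrightarrow> x i \<in> carrier G"
  shows "(\<Otimes>i \<in> {..<m}. x i) = ordered_prod G x m"
  using assms
proof (induction m)
  case (Suc m)
  have "(\<Otimes>i \<in> {..<Suc m}. x i) = x m \<otimes> (\<Otimes>i \<in> {..<m}. x i)"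
    unfolding lessThan_Suc by (rule finprod_insert) (use Suc.prems in auto)
  also have "\<dots> = (\<Otimes>i \<in> {..<m}. x i) \<otimes> x m"
    by (rule m_comm) (use Suc.prems in auto)
  finally show ?case using Suc by simp
qed simp

section \<open>Commutators and the center of an abstract group\<close>

context group
begin

lemma commutator_closed [intro, simp]:
  "x \<in> carrier G \<Longrightarrow> y \<in> carrier G \<Longrightarrow> commutator G x y \<in> carrier G"
  by (simp add: commutator_def)

lemma mult_eq_mult_commutator:
  assumes "x \<in> carrier G" "y \<in> carrier G"
  shows "x \<otimes> y = y \<otimes> x \<otimes> commutator G x y"
  using assms by (simp add: commutator_def m_assoc[symmetric] inv_solve_right)
    (simp add: m_assoc)

text \<open>Allows a commutator to be computed by exhibiting the factor that repairs the order of x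
  and y, without handling inverses.\<close>

lemma commutator_unique:
  assumes "x \<in> carrier G" "y \<in> carrier G" "c \<in> carrier G" "x \<otimes> y = y \<otimes> x \<otimes> c"
  shows "commutator G x y = c"
proof -
  have "y \<otimes> x \<otimes> commutator G x y = y \<otimes> x \<otimes> c"
    unfolding mult_eq_mult_commutator[OF assms(1,2), symmetric] by (rule assms(4))
  then show ?thesis using assms(1-3) by simp
qed

lemma commutator_eq_one_iff:
  assumes "x \<in> carrier G" "y \<in> carrier G"
  shows "commutator G x y = \<one> \<longleftrightarrow> x \<otimes> y = y \<otimes> x"
  using assms mult_eq_mult_commutator[OF assms] commutator_unique[OF assms one_closed]
  by auto

lemma commutator_swap:
  assumes "x \<in> carrier G" "y \<in> carrier G"
  shows "commutator G y x = inv (commutator G x y)"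
  using assms by (simp add: commutator_def inv_mult_group m_assoc)

lemma conj_eq_mult_commutator:
  assumes "x \<in> carrier G" "y \<in> carrier G"
  shows "inv y \<otimes> x \<otimes> y = x \<otimes> commutator G x y"
  using assms by (simp add: commutator_def m_assoc[symmetric])

lemma centerI: "z \<in> carrier G \<Longrightarrow> (\<And>x. x \<in> carrier G \<Longrightarrow> z \<otimes> x = x \<otimes> z) \<Longrightarrow> z \<in> center G"
  by (simp add: center_def)

lemma center_closed: "z \<in> center G \<Longrightarrow> z \<in> carrier G"
  by (simp add: center_def)

lemma center_commute: "z \<in> center G \<Longrightarrow> x \<in> carrier G \<Longrightarrow> z \<otimes> x = x \<otimes> z"
  by (simp add: center_def)

lemma subgroup_center: "subgroup (center G) G"
proof (rule subgroupI)
  show "inv a \<in> center G" if a: "a \<in> center G" for a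
  proof (rule centerI)
    fix g assume g: "g \<in> carrier G"
    have "inv a \<otimes> g = inv (inv g \<otimes> a)"
      using center_closed[OF a] g by (simp add: inv_mult_group)
    also have "inv g \<otimes> a = a \<otimes> inv g"
      by (rule center_commute[symmetric]) (simp_all add: a g)
    also have "inv (a \<otimes> inv g) = g \<otimes> inv a"
      using center_closed[OF a] g by (simp add: inv_mult_group)
    finally show "inv a \<otimes> g = g \<otimes> inv a" .
  qed (simp add: center_closed[OF a])
  show "a \<otimes> b \<in> center G" if ab: "a \<in> center G" "b \<in> center G" for a b
  proof (rule centerI)
    fix g assume g: "g \<in> carrier G"
    have "a \<otimes> b \<otimes> g = a \<otimes> (g \<otimes> b)"
      using ab g by (simp add: m_assoc center_closed center_commute[OF ab(2) g])
    also have "\<dots> = g \<otimes> (a \<otimes> b)"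
      using ab g by (simp add: m_assoc[symmetric] center_closed center_commute[OF ab(1) g])
    finally show "a \<otimes> b \<otimes> g = g \<otimes> (a \<otimes> b)" .
  qed (simp add: center_closed[OF ab(1)] center_closed[OF ab(2)])
  have "\<one> \<in> center G" by (rule centerI) simp_all
  then show "center G \<noteq> {}" by blast
qed (auto simp: center_closed)

lemma center_iff_commutator:
  "z \<in> center G \<longleftrightarrow> z \<in> carrier G \<and> (\<forall>x \<in> carrier G. commutator G z x = \<one>)"
  by (auto intro!: centerI simp: center_closed center_commute commutator_eq_one_iff)

lemma normal_center: "center G \<lhd> G"
  unfolding normal_inv_iff
proof (intro conjI ballI)
  fix x h assume x: "x \<in> carrier G" and h: "h \<in> center G"
  have "x \<otimes> h \<otimes> inv x = h \<otimes> x \<otimes> inv x"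
    by (simp only: center_commute[OF h x])
  also have "\<dots> = h" using x h by (simp add: m_assoc center_closed)
  finally have "x \<otimes> h \<otimes> inv x = h" .
  then show "x \<otimes> h \<otimes> inv x \<in> center G" using h by simp
qed (rule subgroup_center)

lemma central_interchange:
  assumes "a \<in> carrier G" "c \<in> center G" "x \<in> carrier G" "z \<in> carrier G"
  shows "(a \<otimes> c) \<otimes> (x \<otimes> z) = (a \<otimes> x) \<otimes> (c \<otimes> z)"
proof -
  have "(a \<otimes> c) \<otimes> (x \<otimes> z) = a \<otimes> (c \<otimes> x) \<otimes> z"
    using assms by (simp add: m_assoc center_closed)
  also have "c \<otimes> x = x \<otimes> c"
    by (rule center_commute[OF assms(2,3)])
  also have "a \<otimes> (x \<otimes> c) \<otimes> z = (a \<otimes> x) \<otimes> (c \<otimes> z)"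
    using assms by (simp add: m_assoc center_closed)
  finally show ?thesis .
qed

lemma ordered_prod_mult_central:
  assumes "\<And>i. i < n \<Longrightarrow> x i \<in> center G" "\<And>i. i < n \<Longrightarrow> y i \<in> center G"
  shows "ordered_prod G x n \<otimes> ordered_prod G y n = ordered_prod G (\<lambda>i. x i \<otimes> y i) n"
  using assms
proof (induction n)
  case (Suc n)
  have "ordered_prod G x n \<in> carrier G" "ordered_prod G y n \<in> carrier G"
    by (rule ordered_prod_closed, simp add: Suc.prems center_closed)+
  then have "ordered_prod G x (Suc n) \<otimes> ordered_prod G y (Suc n)
      = (ordered_prod G x n \<otimes> ordered_prod G y n) \<otimes> (x n \<otimes> y n)"
    using Suc.prems by (simp add: central_interchange[of "ordered_prod G x n" "x n"] center_closed)
  then show ?case using Suc by simp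
qed simp

end

section \<open>Commutators in 2-nilpotent groups with exponents\<close>

context r_group
begin

lemma inv_rpow: "x \<in> carrier G \<Longrightarrow> inv (x \<up> \<alpha>) = x \<up> (- \<alpha>)"
  by (rule inv_equality) (simp_all add: rpow_closed rpow_add rpow_0)

lemma inv_eq_rpow: "x \<in> carrier G \<Longrightarrow> inv x = x \<up> (- 1)"
  using inv_rpow[of x 1] by (simp add: rpow_1)

lemma rpow_cancel: "x \<in> carrier G \<Longrightarrow> x \<up> \<alpha> \<otimes> x \<up> (- \<alpha>) = \<one>"
  by (simp add: rpow_add rpow_0)

text \<open>Links the exponents of the discrete group with those of a completion: group
  homomorphisms preserve integer powers, so they preserve exponentiation by integers.\<close>

lemma rpow_of_int:
  assumes x: "x \<in> carrier G"
  shows "x \<up> of_int k = x [^] (k :: int)"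
proof -
  have nat: "x \<up> of_nat a = x [^] (a :: nat)" for a
  proof (induction a)
    case (Suc a)
    have "x \<up> of_nat (Suc a) = x \<up> of_nat a \<otimes> x \<up> 1"
      using x by (simp add: rpow_add add.commute)
    then show ?case using Suc x by (simp add: rpow_1)
  qed (simp add: x rpow_0)
  show ?thesis
  proof (cases k)
    case (nonneg a)
    then show ?thesis using nat by (simp add: int_pow_int)
  next
    case (neg a)
    have "x \<up> of_int k = inv (x \<up> of_nat (Suc a))"
      using x neg by (simp add: inv_rpow)
    also have "\<dots> = x [^] k" unfolding nat neg using x by (simp only: int_pow_neg_int)
    finally show ?thesis .
  qed
qed

lemma rpow_mult_commute:
  "x \<in> carrier G \<Longrightarrow> y \<in> carrier G \<Longrightarrow> x \<otimes> y = y \<otimes> x \<Longrightarrow> (x \<otimes> y) \<up> \<alpha> = x \<up> \<alpha> \<otimes> y \<up> \<alpha>"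
  by (rule rpow_mult) (simp_all add: commutator_eq_one_iff)

lemma rpow_center_commute:
  "x \<in> carrier G \<Longrightarrow> z \<in> center G \<Longrightarrow> (x \<otimes> z) \<up> \<alpha> = x \<up> \<alpha> \<otimes> z \<up> \<alpha>"
  by (rule rpow_mult_commute) (simp_all only: center_closed center_commute)

lemma r_generate_minimal: "r_subgroup K G \<Longrightarrow> S \<subseteq> K \<Longrightarrow> r_generate G S \<subseteq> K"
  unfolding r_generate_def by blast

end

locale nil2_rgroup = r_group +
  assumes nil: "two_nilpotent G"
begin

lemma commutator_central:
  "x \<in> carrier G \<Longrightarrow> y \<in> carrier G \<Longrightarrow> commutator G x y \<in> center G"
  using nil by (simp add: center_iff_commutator two_nilpotent_def)

text \<open>Conjugating x by y multiplies x by the central element [x, y]. Exponentiation commutes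
  with conjugation and distributes over a central factor, so conjugating the \<alpha>-th power of x
  multiplies it by the \<alpha>-th power of [x, y].\<close>

lemma commutator_rpow_left:
  assumes x: "x \<in> carrier G" and y: "y \<in> carrier G"
  shows "commutator G (x \<up> \<alpha>) y = commutator G x y \<up> \<alpha>"
proof -
  have "inv y \<otimes> x \<up> \<alpha> \<otimes> y = (x \<otimes> commutator G x y) \<up> \<alpha>"
    by (simp only: rpow_conj[OF x y, symmetric] conj_eq_mult_commutator[OF x y])
  also have "\<dots> = x \<up> \<alpha> \<otimes> commutator G x y \<up> \<alpha>"
    using x y by (simp add: rpow_center_commute commutator_central)
  finally have "x \<up> \<alpha> \<otimes> commutator G (x \<up> \<alpha>) y = x \<up> \<alpha> \<otimes> commutator G x y \<up> \<alpha>"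
    using x y by (simp add: conj_eq_mult_commutator rpow_closed)
  then show ?thesis using x y by (simp add: rpow_closed)
qed

lemma commutator_rpow_right:
  assumes x: "x \<in> carrier G" and y: "y \<in> carrier G"
  shows "commutator G x (y \<up> \<alpha>) = commutator G x y \<up> \<alpha>"
proof -
  have "commutator G x (y \<up> \<alpha>) = inv (commutator G y x \<up> \<alpha>)"
    using x y by (simp add: commutator_swap[of "y \<up> \<alpha>" x] rpow_closed commutator_rpow_left)
  also have "\<dots> = commutator G y x \<up> (- \<alpha>)"
    using x y by (simp add: inv_rpow)
  also have "commutator G y x = commutator G x y \<up> (- 1)"
    using x y by (simp only: commutator_swap[of x y] inv_eq_rpow commutator_closed)
  finally show ?thesis using x y by (simp add: rpow_rpow)
qed

lemma commutator_mult_left: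
  assumes "x \<in> carrier G" "y \<in> carrier G" "z \<in> carrier G"
  shows "commutator G (x \<otimes> y) z = commutator G x z \<otimes> commutator G y z"
proof (rule commutator_unique)
  have "x \<otimes> y \<otimes> z = x \<otimes> (z \<otimes> y \<otimes> commutator G y z)"
    using assms by (simp add: m_assoc mult_eq_mult_commutator[of y z])
  also have "\<dots> = (x \<otimes> z) \<otimes> (y \<otimes> commutator G y z)"
    using assms by (simp add: m_assoc)
  also have "\<dots> = (z \<otimes> x \<otimes> commutator G x z) \<otimes> (y \<otimes> commutator G y z)"
    using assms by (simp add: mult_eq_mult_commutator[of x z])
  also have "\<dots> = (z \<otimes> x \<otimes> y) \<otimes> (commutator G x z \<otimes> commutator G y z)"
    using assms by (intro central_interchange) (auto intro: commutator_central)
  finally show "x \<otimes> y \<otimes> z = z \<otimes> (x \<otimes> y) \<otimes> (commutator G x z \<otimes> commutator G y z)"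
    using assms by (simp add: m_assoc)
qed (use assms in auto)

lemma commutator_mult_right:
  assumes "x \<in> carrier G" "y \<in> carrier G" "z \<in> carrier G"
  shows "commutator G z (x \<otimes> y) = commutator G z x \<otimes> commutator G z y"
proof -
  have "commutator G z (x \<otimes> y) = inv (commutator G x z \<otimes> commutator G y z)"
    using assms by (simp add: commutator_swap[of "x \<otimes> y" z] commutator_mult_left)
  also have "\<dots> = commutator G z y \<otimes> commutator G z x"
    using assms by (simp add: inv_mult_group commutator_swap[of x z] commutator_swap[of y z])
  also have "\<dots> = commutator G z x \<otimes> commutator G z y"
    by (rule center_commute) (simp_all add: assms commutator_central)
  finally show ?thesis .
qed

lemma rpow_central: "z \<in> center G \<Longrightarrow> z \<up> \<alpha> \<in> center G"
  by (simp add: center_iff_commutator rpow_closed commutator_rpow_left one_rpow)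

lemma r_subgroup_center: "r_subgroup (center G) G"
  by (simp add: r_subgroup_def subgroup_center rpow_central)

text \<open>The centralizer of z is closed under exponents because [z, y] = 1 forces every
  [z, y^\<alpha>] to be a power of 1. Testing z on a set of R-generators is therefore
  enough.\<close>

lemma centralI:
  assumes S: "r_generate G S = carrier G" "S \<subseteq> carrier G" and z: "z \<in> carrier G"
    and comm: "\<And>s. s \<in> S \<Longrightarrow> commutator G z s = \<one>"
  shows "z \<in> center G"
proof -
  let ?K = "{x \<in> carrier G. commutator G z x = \<one>}"
  have "subgroup ?K G"
  proof (rule subgroupI)
    show "?K \<noteq> {}" using z by (auto simp: commutator_eq_one_iff intro!: exI[of _ \<one>])
    show "inv a \<in> ?K" if "a \<in> ?K" for a
      using that z commutator_rpow_right[of z a "-1"]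
      by (simp add: inv_eq_rpow one_rpow rpow_closed)
  qed (auto simp: z commutator_mult_right)
  then have "r_subgroup ?K G"
    using z by (auto simp: r_subgroup_def rpow_closed commutator_rpow_right one_rpow)
  then have "r_generate G S \<subseteq> ?K"
    by (rule r_generate_minimal) (use S comm in auto)
  then show ?thesis using S z by (auto simp: center_iff_commutator)
qed

lemma commutator_ordered_prod:
  assumes "x \<in> carrier G" "\<And>i. i < m \<Longrightarrow> y i \<in> carrier G"
  shows "commutator G x (ordered_prod G y m) = ordered_prod G (\<lambda>i. commutator G x (y i)) m"
  using assms(2)
proof (induction m)
  case 0
  then show ?case using assms(1) by (simp add: commutator_eq_one_iff)
next
  case (Suc m)
  then show ?case using assms(1) by (simp add: commutator_mult_right ordered_prod_closed)
qed

lemma ordered_prod_rpow_central: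
  assumes "\<And>i. i < n \<Longrightarrow> x i \<in> center G"
  shows "ordered_prod G x n \<up> \<alpha> = ordered_prod G (\<lambda>i. x i \<up> \<alpha>) n"
  using assms
  by (induction n)
    (simp_all add: one_rpow rpow_center_commute ordered_prod_closed center_closed)

lemma c_commutator_central:
  assumes g: "g \<in> carrier G" and h: "h \<in> carrier G"
  shows "c_commutator G g h \<alpha> \<in> center G"
proof -
  have "commutator G (h \<up> (- \<alpha>) \<otimes> g \<up> (- \<alpha>) \<otimes> (g \<otimes> h) \<up> \<alpha>) z = \<one>" if z: "z \<in> carrier G" for z
  proof -
    let ?a = "commutator G g z" and ?b = "commutator G h z"
    \<comment> \<open>Centrality of [h, z] is what permits splitting the \<alpha>-th power of
      [gh, z] = [g, z][h, z].\<close>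
    have ab: "?a \<in> carrier G" "?b \<in> center G" using g h z by (auto intro: commutator_central)
    have "commutator G (h \<up> (- \<alpha>) \<otimes> g \<up> (- \<alpha>) \<otimes> (g \<otimes> h) \<up> \<alpha>) z
        = ?b \<up> (- \<alpha>) \<otimes> ?a \<up> (- \<alpha>) \<otimes> (?a \<up> \<alpha> \<otimes> ?b \<up> \<alpha>)"
      using g h z ab
      by (simp add: commutator_mult_left commutator_rpow_left rpow_closed rpow_center_commute)
    also have "?b \<up> (- \<alpha>) \<otimes> ?a \<up> (- \<alpha>) = inv (?a \<up> \<alpha> \<otimes> ?b \<up> \<alpha>)"
      using ab center_closed by (simp add: inv_mult_group rpow_closed inv_rpow)
    finally show ?thesis using ab center_closed by (simp add: rpow_closed)
  qed
  then have "h \<up> (- \<alpha>) \<otimes> g \<up> (- \<alpha>) \<otimes> (g \<otimes> h) \<up> \<alpha> \<in> center G"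
    using g h by (simp add: center_iff_commutator rpow_closed)
  then show ?thesis
    unfolding c_commutator_def
    by (rule subgroup.m_closed[OF subgroup_center rpow_central[OF commutator_central[OF g h]]])
qed

text \<open>This is the definition of the c-commutator solved for the power of gh; it exhibits the
  c-commutator as the error factor in Hall's power formula.\<close>

lemma rpow_mult_c_commutator:
  assumes g: "g \<in> carrier G" and h: "h \<in> carrier G"
  shows "(g \<otimes> h) \<up> \<alpha> = g \<up> \<alpha> \<otimes> h \<up> \<alpha> \<otimes> commutator G g h \<up> (- rbinom \<alpha> 2) \<otimes> c_commutator G g h \<alpha>"
proof -
  let ?c = "commutator G g h"
  let ?d = "h \<up> (- \<alpha>) \<otimes> g \<up> (- \<alpha>) \<otimes> (g \<otimes> h) \<up> \<alpha>"
  have c: "?c \<in> carrier G" and d: "?d \<in> carrier G" using g h by (simp_all add: rpow_closed)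
  have "?c \<up> (- rbinom \<alpha> 2) \<otimes> c_commutator G g h \<alpha>
      = ?c \<up> (- rbinom \<alpha> 2) \<otimes> ?c \<up> rbinom \<alpha> 2 \<otimes> ?d"
    unfolding c_commutator_def using c d by (simp only: m_assoc rpow_closed)
  also have "\<dots> = ?d" unfolding rpow_add[OF c] using c d by (simp add: rpow_0)
  finally have *: "?c \<up> (- rbinom \<alpha> 2) \<otimes> c_commutator G g h \<alpha> = ?d" .
  have C: "c_commutator G g h \<alpha> \<in> carrier G"
    by (rule center_closed[OF c_commutator_central[OF g h]])
  have "g \<up> \<alpha> \<otimes> h \<up> \<alpha> \<otimes> ?d = g \<up> \<alpha> \<otimes> (h \<up> \<alpha> \<otimes> h \<up> (- \<alpha>)) \<otimes> g \<up> (- \<alpha>) \<otimes> (g \<otimes> h) \<up> \<alpha>"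
    using g h by (simp only: m_assoc rpow_closed m_closed)
  also have "\<dots> = (g \<otimes> h) \<up> \<alpha>"
    using g h by (simp add: rpow_cancel rpow_closed)
  finally show ?thesis
    unfolding *[symmetric] using g h c C by (simp add: m_assoc rpow_closed)
qed

text \<open>
  The commutator factor of the preceding expansion lies in \<open>A\<close> since $[g,h]^\beta=[g^\beta,h]$.
\<close>

lemma rpow_mult_in_subgroup:
  assumes A: "subgroup A G" and C: "\<And>\<alpha>. c_commutator G g h \<alpha> \<in> A"
    and g: "g \<in> carrier G" "\<And>\<alpha>. g \<up> \<alpha> \<in> A" and h: "h \<in> carrier G" "\<And>\<alpha>. h \<up> \<alpha> \<in> A"
  shows "(g \<otimes> h) \<up> \<alpha> \<in> A"
proof -
  have "commutator G x y \<in> A" if "x \<in> A" "y \<in> A" for x y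
    unfolding commutator_def using that
    by (intro subgroup.m_closed[OF A] subgroup.m_inv_closed[OF A])
  then have "commutator G g h \<up> \<beta> \<in> A" for \<beta>
    using commutator_rpow_left[OF g(1) h(1), of \<beta>] g(2)[of \<beta>] h(2)[of 1] h(1)
    by (metis rpow_1)
  then show ?thesis
    unfolding rpow_mult_c_commutator[OF g(1) h(1)]
    by (intro subgroup.m_closed[OF A] g h C)
qed

text \<open>\<open>A\<close> is not assumed closed under exponents, since the lemma serves to prove
  exactly that for one particular \<open>A\<close>. Hence all powers of each factor are required to
  lie in \<open>A\<close>, and the induction carries all powers of the prefix.\<close>

lemma ordered_prod_rpow_in_subgroup:
  assumes A: "subgroup A G"
    and C: "\<And>g h \<alpha>. g \<in> carrier G \<Longrightarrow> h \<in> carrier G \<Longrightarrow> c_commutator G g h \<alpha> \<in> A"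
    and x: "\<And>i. i < m \<Longrightarrow> x i \<in> carrier G" "\<And>i \<alpha>. i < m \<Longrightarrow> x i \<up> \<alpha> \<in> A"
  shows "ordered_prod G x m \<up> \<alpha> \<in> A"
  using x
proof (induction m arbitrary: \<alpha>)
  case 0
  then show ?case using A by (simp add: one_rpow subgroup.one_closed)
next
  case (Suc m)
  then show ?case
    using A C by (simp add: rpow_mult_in_subgroup ordered_prod_closed)
qed

end

section \<open>Hall's multiplication formula\<close>

text \<open>The l-th coordinate of Hall's correction, the sum of \<alpha>_i \<gamma>_j k(i,j) over i
  > j. Bilinearity yields the group and exponent laws; strict triangularity makes ordered products
  of basis powers free of corrections.\<close>

definition hall_form ::
    "(nat \<Rightarrow> nat \<Rightarrow> nat \<Rightarrow> int) \<Rightarrow> nat \<Rightarrow> (nat \<Rightarrow> 'r :: comm_ring_1) \<Rightarrow> (nat \<Rightarrow> 'r) \<Rightarrow> nat \<Rightarrow> 'r" where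
  "hall_form k m a c l = (\<Sum>i<m. \<Sum>j<i. a i * c j * of_int (k i j l))"

lemma hall_form_add_left:
  "hall_form k m (\<lambda>i. a i + b i) c l = hall_form k m a c l + hall_form k m b c l"
  by (simp add: hall_form_def sum.distrib algebra_simps)

lemma hall_form_add_right:
  "hall_form k m a (\<lambda>i. c i + d i) l = hall_form k m a c l + hall_form k m a d l"
  by (simp add: hall_form_def sum.distrib algebra_simps)

lemma hall_form_scale_left:
  "hall_form k m (\<lambda>i. \<alpha> * a i) c l = \<alpha> * hall_form k m a c l"
  by (simp add: hall_form_def sum_distrib_left algebra_simps)

lemma hall_form_scale_right:
  "hall_form k m a (\<lambda>i. \<alpha> * c i) l = \<alpha> * hall_form k m a c l"
  by (simp add: hall_form_def sum_distrib_left algebra_simps)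

lemma hall_form_minus_left: "hall_form k m (\<lambda>i. - a i) c l = - hall_form k m a c l"
  by (simp add: hall_form_def sum_negf)

lemma hall_form_minus_right: "hall_form k m a (\<lambda>i. - c i) l = - hall_form k m a c l"
  by (simp add: hall_form_def sum_negf)

lemma hall_form_diff_left:
  "hall_form k m (\<lambda>i. a i - b i) c l = hall_form k m a c l - hall_form k m b c l"
  by (simp add: hall_form_def sum_subtractf algebra_simps)

lemma hall_form_diff_right:
  "hall_form k m a (\<lambda>i. c i - d i) l = hall_form k m a c l - hall_form k m a d l"
  by (simp add: hall_form_def sum_subtractf algebra_simps)

lemma hall_form_zero_left: "hall_form k m (\<lambda>i. 0) c l = 0"
  by (simp add: hall_form_def)

lemma hall_form_zero_right: "hall_form k m a (\<lambda>i. 0) l = 0"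
  by (simp add: hall_form_def)

lemmas hall_form_linear =
  hall_form_add_left hall_form_add_right hall_form_scale_left hall_form_scale_right
  hall_form_minus_left hall_form_minus_right hall_form_diff_left hall_form_diff_right
  hall_form_zero_left hall_form_zero_right

text \<open>Independence of the u_i and v_j is left out on purpose, so that the frame passes from
  the discrete group to its completions. The constants are integers because they are determined in
  the discrete group.\<close>

locale hall_frame = nil2_rgroup +
  fixes m :: nat and u :: "nat \<Rightarrow> 'a" and n :: nat and v :: "nat \<Rightarrow> 'a"
    and k :: "nat \<Rightarrow> nat \<Rightarrow> nat \<Rightarrow> int"
  assumes u_closed: "i < m \<Longrightarrow> u i \<in> carrier G"
    and v_central: "j < n \<Longrightarrow> v j \<in> center G"
    and u_commutator: "j < i \<Longrightarrow> i < m \<Longrightarrow>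
      commutator G (u i) (u j) = ordered_prod G (\<lambda>l. v l \<up> of_int (k i j l)) n"
begin

text \<open>The length \<open>t\<close> is a parameter to allow induction over prefixes in
  \<open>upart_mult\<close>.\<close>

definition upart :: "(nat \<Rightarrow> 'b) \<Rightarrow> nat \<Rightarrow> 'a" where
  "upart a t = ordered_prod G (\<lambda>i. u i \<up> a i) t"

definition vpart :: "(nat \<Rightarrow> 'b) \<Rightarrow> 'a" where
  "vpart b = ordered_prod G (\<lambda>j. v j \<up> b j) n"

lemma upart_closed: "t \<le> m \<Longrightarrow> upart a t \<in> carrier G"
  unfolding upart_def by (rule ordered_prod_closed) (simp add: rpow_closed u_closed)

lemma vpart_central: "vpart b \<in> center G"
  unfolding vpart_def
  by (rule ordered_prod_in_subgroup[OF subgroup_center]) (simp add: rpow_central v_central)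

lemma vpart_closed: "vpart b \<in> carrier G"
  by (rule center_closed[OF vpart_central])

lemma vpart_add: "vpart b \<otimes> vpart d = vpart (\<lambda>l. b l + d l)"
proof -
  have "vpart b \<otimes> vpart d = ordered_prod G (\<lambda>j. v j \<up> b j \<otimes> v j \<up> d j) n"
    unfolding vpart_def
    by (rule ordered_prod_mult_central) (simp_all add: rpow_central v_central)
  also have "\<dots> = vpart (\<lambda>l. b l + d l)"
    unfolding vpart_def
    by (rule ordered_prod_cong) (simp add: rpow_add center_closed v_central)
  finally show ?thesis .
qed

lemma vpart_zero: "vpart (\<lambda>l. 0) = \<one>"
proof -
  have "vpart (\<lambda>l. 0) = ordered_prod G (\<lambda>j. \<one>) n"
    unfolding vpart_def by (rule ordered_prod_cong) (simp add: rpow_0 center_closed v_central)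
  then show ?thesis by (simp add: ordered_prod_one)
qed

lemma upart_zero: "t \<le> m \<Longrightarrow> upart (\<lambda>i. 0) t = \<one>"
proof -
  assume "t \<le> m"
  then have "upart (\<lambda>i. 0) t = ordered_prod G (\<lambda>j. \<one>) t"
    unfolding upart_def by (intro ordered_prod_cong) (simp add: rpow_0 u_closed)
  then show ?thesis by (simp add: ordered_prod_one)
qed

lemma vpart_rpow: "vpart b \<up> \<alpha> = vpart (\<lambda>l. b l * \<alpha>)"
proof -
  have "vpart b \<up> \<alpha> = ordered_prod G (\<lambda>j. (v j \<up> b j) \<up> \<alpha>) n"
    unfolding vpart_def
    by (rule ordered_prod_rpow_central) (simp add: rpow_central v_central)
  also have "\<dots> = vpart (\<lambda>l. b l * \<alpha>)"
    unfolding vpart_def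
    by (rule ordered_prod_cong) (simp add: rpow_rpow center_closed v_central)
  finally show ?thesis .
qed

lemma ordered_prod_vpart: "ordered_prod G (\<lambda>j. vpart (b j)) t = vpart (\<lambda>l. \<Sum>j<t. b j l)"
  by (induction t) (simp_all add: vpart_zero vpart_add)

lemma commutator_upart:
  assumes t: "t < m"
  shows "commutator G (u t \<up> \<alpha>) (upart c t) = vpart (\<lambda>l. \<Sum>j<t. \<alpha> * c j * of_int (k t j l))"
proof -
  have "commutator G (u t \<up> \<alpha>) (upart c t)
      = ordered_prod G (\<lambda>j. commutator G (u t \<up> \<alpha>) (u j \<up> c j)) t"
    unfolding upart_def using t
    by (intro commutator_ordered_prod) (simp_all add: rpow_closed u_closed)
  also have "\<dots> = ordered_prod G (\<lambda>j. vpart (\<lambda>l. \<alpha> * c j * of_int (k t j l))) t"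
  proof (rule ordered_prod_cong)
    fix j assume j: "j < t"
    have "commutator G (u t \<up> \<alpha>) (u j \<up> c j) = vpart (\<lambda>l. of_int (k t j l)) \<up> (\<alpha> * c j)"
      using t j
      by (simp add: commutator_rpow_left commutator_rpow_right rpow_closed u_closed rpow_rpow
          u_commutator vpart_def[symmetric] vpart_closed mult.commute)
    then show "commutator G (u t \<up> \<alpha>) (u j \<up> c j) = vpart (\<lambda>l. \<alpha> * c j * of_int (k t j l))"
      by (simp add: vpart_rpow mult.commute)
  qed
  finally show ?thesis by (simp add: ordered_prod_vpart)
qed

text \<open>Collection process: in the step, the power of u_t from the left factor must pass all u_j
  with j < t of the right factor. The central commutator this produces is the row i = t of the
  form.\<close>

lemma upart_mult:
  "t \<le> m \<Longrightarrow> upart a t \<otimes> upart c t = upart (\<lambda>i. a i + c i) t \<otimes> vpart (hall_form k t a c)"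
proof (induction t)
  case 0
  have "hall_form k 0 a c = (\<lambda>l. 0)" by (simp add: hall_form_def fun_eq_iff)
  then show ?case by (simp add: upart_def vpart_zero)
next
  case (Suc t)
  define x y A B where "x = u t \<up> a t" and "y = u t \<up> c t" and "A = upart a t" and "B = upart c t"
  let ?f = "\<lambda>l. \<Sum>j<t. a t * c j * of_int (k t j l)"
  let ?S = "upart (\<lambda>i. a i + c i) t" and ?V = "vpart (hall_form k t a c)" and ?W = "vpart ?f"
  have t: "t < m" using Suc.prems by simp
  have cl: "x \<in> carrier G" "y \<in> carrier G" "A \<in> carrier G" "B \<in> carrier G" "?S \<in> carrier G"
    using t by (simp_all add: x_def y_def A_def B_def rpow_closed u_closed upart_closed)
  have xB: "x \<otimes> B = B \<otimes> x \<otimes> ?W"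
    unfolding mult_eq_mult_commutator[OF cl(1) cl(4)] unfolding x_def B_def commutator_upart[OF t] ..
  have "upart a (Suc t) \<otimes> upart c (Suc t) = A \<otimes> (x \<otimes> B) \<otimes> y"
    using cl by (simp add: upart_def A_def B_def x_def y_def m_assoc)
  \<comment> \<open>The factor \<one> only brings the product into the four-factor shape of
    \<open>central_interchange\<close>, which then moves the central element \<open>?W\<close> to
    the right end; \<open>?V\<close> is treated in the same way below.\<close>
  also have "\<dots> = ((A \<otimes> B) \<otimes> x) \<otimes> ?W \<otimes> (y \<otimes> \<one>)"
    unfolding xB using cl vpart_closed by (simp add: m_assoc)
  also have "\<dots> = ((A \<otimes> B) \<otimes> x \<otimes> y) \<otimes> (?W \<otimes> \<one>)"
    using cl by (intro central_interchange) (auto simp: vpart_central)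
  also have "A \<otimes> B = ?S \<otimes> ?V" unfolding A_def B_def using Suc by simp
  also have "?S \<otimes> ?V \<otimes> x \<otimes> y = ?S \<otimes> ?V \<otimes> (x \<otimes> y \<otimes> \<one>)"
    using cl vpart_closed by (simp add: m_assoc)
  also have "\<dots> = ?S \<otimes> (x \<otimes> y) \<otimes> (?V \<otimes> \<one>)"
    using cl by (intro central_interchange) (auto simp: vpart_central)
  also have "x \<otimes> y = u t \<up> (a t + c t)"
    unfolding x_def y_def by (rule rpow_add[OF u_closed[OF t]])
  also have "?S \<otimes> u t \<up> (a t + c t) \<otimes> (?V \<otimes> \<one>) \<otimes> (?W \<otimes> \<one>) =
      upart (\<lambda>i. a i + c i) (Suc t) \<otimes> (?V \<otimes> ?W)"
    using cl vpart_closed t by (simp add: upart_def m_assoc rpow_closed u_closed)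
  also have "?V \<otimes> ?W = vpart (hall_form k (Suc t) a c)"
    by (simp add: vpart_add hall_form_def[abs_def])
  finally show ?case .
qed

section \<open>Normal forms and the subgroup they constitute\<close>

definition uv :: "(nat \<Rightarrow> 'b) \<Rightarrow> (nat \<Rightarrow> 'b) \<Rightarrow> 'a" where
  "uv a b = upart a m \<otimes> vpart b"

lemma uv_products_eq: "uv_products G m u n v = {uv a b | a b. True}"
  by (simp add: uv_products_def uv_def upart_def vpart_def)

lemma uv_in_uv_products: "uv a b \<in> uv_products G m u n v"
  unfolding uv_products_eq by blast

lemma uv_productsE:
  assumes "x \<in> uv_products G m u n v"
  obtains a b where "x = uv a b"
  using assms unfolding uv_products_eq by blast

lemma uv_closed: "uv a b \<in> carrier G"
  by (simp add: uv_def upart_closed vpart_closed)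

lemma uv_mult:
  "uv a b \<otimes> uv c d = uv (\<lambda>i. a i + c i) (\<lambda>l. b l + d l + hall_form k m a c l)"
proof -
  have "uv a b \<otimes> uv c d = upart a m \<otimes> upart c m \<otimes> (vpart b \<otimes> vpart d)"
    unfolding uv_def by (intro central_interchange) (simp_all add: upart_closed vpart_central vpart_closed)
  also have "\<dots> = upart (\<lambda>i. a i + c i) m \<otimes> (vpart (hall_form k m a c) \<otimes> (vpart b \<otimes> vpart d))"
    by (simp add: upart_mult upart_closed vpart_closed m_assoc)
  also have "\<dots> = uv (\<lambda>i. a i + c i) (\<lambda>l. b l + d l + hall_form k m a c l)"
    by (simp add: uv_def vpart_add algebra_simps)
  finally show ?thesis .
qed

lemma uv_zero: "uv (\<lambda>i. 0) (\<lambda>l. 0) = \<one>"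
  by (simp add: uv_def upart_zero vpart_zero)

lemma uv_cong:
  "(\<And>i. i < m \<Longrightarrow> a i = a' i) \<Longrightarrow> (\<And>l. l < n \<Longrightarrow> b l = b' l) \<Longrightarrow> uv a b = uv a' b'"
  unfolding uv_def upart_def vpart_def
  by (intro arg_cong2[of _ _ _ _ "(\<otimes>)"] ordered_prod_cong) auto

text \<open>The form takes the value - \<open>hall_form k m a a l\<close> on -a and a; the term
  added to the v-exponents cancels it.\<close>

lemma uv_inv: "inv (uv a b) = uv (\<lambda>i. - a i) (\<lambda>l. - b l + hall_form k m a a l)"
  by (rule inv_equality) (simp_all add: uv_mult uv_closed hall_form_linear uv_zero)

lemma subgroup_uv_products: "subgroup (uv_products G m u n v) G"
proof (rule subgroupI)
  show "uv_products G m u n v \<noteq> {}" using uv_in_uv_products by blast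
qed (auto simp: uv_closed uv_inv uv_mult uv_in_uv_products elim!: uv_productsE)

lemma u_rpow_eq_uv:
  assumes i: "i < m"
  shows "u i \<up> \<alpha> = uv (\<lambda>j. if j = i then \<alpha> else 0) (\<lambda>l. 0)"
proof -
  have "upart (\<lambda>j. if j = i then \<alpha> else 0) m
      = ordered_prod G (\<lambda>j. if j = i then u i \<up> \<alpha> else \<one>) m"
    unfolding upart_def by (rule ordered_prod_cong) (simp add: rpow_0 u_closed)
  then show ?thesis
    using i by (simp add: uv_def ordered_prod_single rpow_closed u_closed vpart_zero)
qed

lemma vpart_eq_uv: "vpart b = uv (\<lambda>i. 0) b"
  by (simp add: uv_def upart_zero vpart_closed)

lemma v_rpow_eq_uv:
  assumes i: "i < n"
  shows "v i \<up> \<alpha> = uv (\<lambda>j. 0) (\<lambda>l. if l = i then \<alpha> else 0)"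
proof -
  have "vpart (\<lambda>j. if j = i then \<alpha> else 0)
      = ordered_prod G (\<lambda>j. if j = i then v i \<up> \<alpha> else \<one>) n"
    unfolding vpart_def
    by (rule ordered_prod_cong) (simp add: rpow_0 center_closed v_central)
  then show ?thesis
    using i
    by (simp add: vpart_eq_uv[symmetric] ordered_prod_single rpow_closed center_closed v_central)
qed

text \<open>Used in both completions: in the tensor completion it gives the factorization behind the
  direct product, and in the Hall completion, where \<open>C\<close> is trivial, it shows that every
  element is a normal form.\<close>

lemma uv_products_mult_c_commutators:
  assumes S: "S \<subseteq> uv_products G m u n v" "r_generate G S = carrier G" and x: "x \<in> carrier G"
  defines "C \<equiv> r_generate G {c_commutator G g h \<alpha> | g h \<alpha>. g \<in> carrier G \<and> h \<in> carrier G}"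
  shows "\<exists>y \<in> uv_products G m u n v. \<exists>c \<in> C. x = y \<otimes> c"
proof -
  let ?H = "uv_products G m u n v"
  let ?X = "{c_commutator G g h \<alpha> | g h \<alpha>. g \<in> carrier G \<and> h \<in> carrier G}"
  define A where "A = {y \<otimes> c | y c. y \<in> ?H \<and> c \<in> C}"
  have X: "?X \<subseteq> center G" by (auto intro: c_commutator_central)
  have CZ: "C \<subseteq> center G"
    unfolding C_def by (rule r_generate_minimal[OF r_subgroup_center X])
  have C: "r_subgroup C G"
    unfolding C_def
    by (rule r_subgroup_r_generate) (auto intro!: center_closed c_commutator_central)
  have Csub: "subgroup C G" and Cpow: "\<And>c \<alpha>. c \<in> C \<Longrightarrow> c \<up> \<alpha> \<in> C"
    using C by (auto simp: r_subgroup_def)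
  have Hcl: "y \<in> carrier G" if "y \<in> ?H" for y
    using that by (rule subgroup.mem_carrier[OF subgroup_uv_products])
  have Ccl: "c \<in> carrier G" if "c \<in> C" for c using that CZ center_closed by blast
  have A: "subgroup A G"
  proof (rule subgroupI)
    have "uv a b \<otimes> \<one> \<in> A" for a b
      unfolding A_def using uv_in_uv_products subgroup.one_closed[OF Csub] by blast
    then show "A \<noteq> {}" by blast
    show "A \<subseteq> carrier G" unfolding A_def using Hcl Ccl by auto
    show "inv z \<in> A" if z: "z \<in> A" for z
    proof -
      obtain y c where yc: "z = y \<otimes> c" "y \<in> ?H" "c \<in> C" using z unfolding A_def by blast
      have "inv z = inv c \<otimes> inv y" using yc Hcl Ccl by (simp add: inv_mult_group)
      also have "\<dots> = inv y \<otimes> inv c"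
        using yc CZ Hcl by (intro center_commute subgroup.m_inv_closed[OF subgroup_center]) auto
      finally show ?thesis
        unfolding A_def using yc subgroup.m_inv_closed[OF Csub]
          subgroup.m_inv_closed[OF subgroup_uv_products] by blast
    qed
    show "z \<otimes> z' \<in> A" if z: "z \<in> A" "z' \<in> A" for z z'
    proof -
      obtain y c where yc: "z = y \<otimes> c" "y \<in> ?H" "c \<in> C" using z unfolding A_def by blast
      obtain y' c' where yc': "z' = y' \<otimes> c'" "y' \<in> ?H" "c' \<in> C" using z unfolding A_def by blast
      have "z \<otimes> z' = (y \<otimes> y') \<otimes> (c \<otimes> c')"
        unfolding yc yc' using yc yc' CZ Hcl Ccl by (intro central_interchange) auto
      then show ?thesis
        unfolding A_def using yc yc' subgroup.m_closed[OF Csub]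
          subgroup.m_closed[OF subgroup_uv_products] by blast
    qed
  qed
  have HA: "?H \<subseteq> A"
  proof
    fix y assume y: "y \<in> ?H"
    then have "y = y \<otimes> \<one>" by (simp add: Hcl)
    then show "y \<in> A" unfolding A_def using y subgroup.one_closed[OF Csub] by blast
  qed
  have CA: "C \<subseteq> A"
  proof
    fix c assume c: "c \<in> C"
    have "\<one> \<otimes> c \<in> A"
      unfolding A_def using c subgroup.one_closed[OF subgroup_uv_products] by blast
    then show "c \<in> A" using c Ccl by simp
  qed
  have ccA: "c_commutator G g h \<alpha> \<in> A" if "g \<in> carrier G" "h \<in> carrier G" for g h \<alpha>
    using that CA r_generate_incl[of ?X G] unfolding C_def by blast
  \<comment> \<open>Only the u-part has noncommuting factors and produces c-commutators. Each of its
    factors is a power of a single u_i, whose powers are again normal forms; the central v-part is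
    split off afterwards.\<close>
  have "upart a m \<up> \<alpha> \<in> A" for a \<alpha>
    unfolding upart_def
  proof (rule ordered_prod_rpow_in_subgroup[OF A ccA])
    fix i \<alpha> assume i: "i < m"
    show "(u i \<up> a i) \<up> \<alpha> \<in> A"
      unfolding rpow_rpow[OF u_closed[OF i]] unfolding u_rpow_eq_uv[OF i]
      by (rule subsetD[OF HA uv_in_uv_products])
  qed (simp_all add: rpow_closed u_closed)
  moreover have vpartA: "vpart b \<in> A" for b
    unfolding vpart_eq_uv by (rule subsetD[OF HA uv_in_uv_products])
  ultimately have Hpow: "uv a b \<up> \<alpha> \<in> A" for a b \<alpha>
    using subgroup.m_closed[OF A] vpartA
    by (simp add: uv_def rpow_center_commute upart_closed vpart_central vpart_rpow)
  have "z \<up> \<alpha> \<in> A" if z: "z \<in> A" for z \<alpha>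
  proof -
    obtain y c where yc: "z = y \<otimes> c" "y \<in> ?H" "c \<in> C" using z unfolding A_def by blast
    then have "z \<up> \<alpha> = y \<up> \<alpha> \<otimes> c \<up> \<alpha>" using CZ Hcl by (simp add: rpow_center_commute subsetD)
    moreover have "y \<up> \<alpha> \<in> A" using yc(2) Hpow unfolding uv_products_eq by blast
    ultimately show ?thesis using subgroup.m_closed[OF A] CA Cpow yc(3) by (simp add: subsetD)
  qed
  then have "r_subgroup A G" using A by (simp add: r_subgroup_def)
  then have "carrier G \<subseteq> A"
    unfolding S(2)[symmetric] using S(1) HA by (intro r_generate_minimal) auto
  then show ?thesis using x unfolding A_def by blast
qed

end

section \<open>The concrete Hall group\<close>

text \<open>A description without division, so that identities between binomials can be checked in
  the ring itself and 2 cancelled afterwards.\<close>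

lemma two_rbinom:
  fixes \<alpha> :: "'r :: {idom, ring_char_0}"
  assumes "binomial_domain TYPE('r)"
  shows "2 * rbinom \<alpha> 2 = \<alpha> * (\<alpha> - 1)"
proof -
  have "to_fract (2 * rbinom \<alpha> 2) = 2 * (to_fract \<alpha> gchoose 2)"
    unfolding mult_2 to_fract_add to_fract_rbinom[OF assms] ..
  also have "\<dots> = to_fract \<alpha> * (to_fract \<alpha> - 1)"
    by (simp add: gbinomial_prod_rev numeral_2_eq_2)
  also have "\<dots> = to_fract (\<alpha> * (\<alpha> - 1))" by simp
  finally show ?thesis by (simp only: to_fract_eq_iff)
qed

text \<open>The sum rule is what the law for x^\<alpha> x^\<beta> demands in the concrete Hall
  group, and the product rule is what the law for (x^\<alpha>)^\<beta> demands.\<close>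

lemma
  fixes \<alpha> \<beta> :: "'r :: {idom, ring_char_0}"
  assumes R: "binomial_domain TYPE('r)"
  shows rbinom_0: "rbinom (0 :: 'r) 2 = 0"
    and rbinom_1: "rbinom (1 :: 'r) 2 = 0"
    and rbinom_add: "rbinom (\<alpha> + \<beta>) 2 = rbinom \<alpha> 2 + rbinom \<beta> 2 + \<alpha> * \<beta>"
    and rbinom_mult: "rbinom (\<alpha> * \<beta>) 2 = \<beta> * rbinom \<alpha> 2 + rbinom \<beta> 2 * \<alpha> * \<alpha>"
proof -
  have eqI: "x = y" if "2 * x = 2 * y" for x y :: 'r using that by simp
  note two = two_rbinom[OF R]
  show "rbinom (0 :: 'r) 2 = 0" "rbinom (1 :: 'r) 2 = 0"
    using two[of 0] two[of 1] by simp_all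
  show "rbinom (\<alpha> + \<beta>) 2 = rbinom \<alpha> 2 + rbinom \<beta> 2 + \<alpha> * \<beta>"
    by (rule eqI) (simp add: distrib_left two algebra_simps)
  have "2 * (\<beta> * rbinom \<alpha> 2 + rbinom \<beta> 2 * \<alpha> * \<alpha>)
      = \<beta> * (2 * rbinom \<alpha> 2) + (2 * rbinom \<beta> 2) * \<alpha> * \<alpha>"
    by (simp add: algebra_simps)
  also have "\<dots> = 2 * rbinom (\<alpha> * \<beta>) 2" unfolding two by (simp add: algebra_simps)
  finally show "rbinom (\<alpha> * \<beta>) 2 = \<beta> * rbinom \<alpha> 2 + rbinom \<beta> 2 * \<alpha> * \<alpha>"
    by (rule eqI[symmetric])
qed

text \<open>Whole sequences replace tuples of lengths m and n, which spares all index bounds. The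
  form reads its arguments only below m, so further u-coordinates are merely added and
  scaled.\<close>

definition hall_model ::
    "(nat \<Rightarrow> nat \<Rightarrow> nat \<Rightarrow> int) \<Rightarrow> nat \<Rightarrow> ((nat \<Rightarrow> 'r) \<times> (nat \<Rightarrow> 'r), 'r :: {idom, ring_char_0}) rgroup" where
  "hall_model k m =
     \<lparr> carrier = UNIV,
       monoid.mult = (\<lambda>(a, b) (c, d). (\<lambda>i. a i + c i, \<lambda>l. b l + d l + hall_form k m a c l)),
       one = (\<lambda>i. 0, \<lambda>l. 0),
       rpow = (\<lambda>(a, b) \<alpha>. (\<lambda>i. \<alpha> * a i, \<lambda>l. \<alpha> * b l + rbinom \<alpha> 2 * hall_form k m a a l)) \<rparr>"

lemma hall_model_simps:
  "carrier (hall_model k m) = UNIV"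
  "\<one>\<^bsub>hall_model k m\<^esub> = (\<lambda>i. 0, \<lambda>l. 0)"
  "(a, b) \<otimes>\<^bsub>hall_model k m\<^esub> (c, d) = (\<lambda>i. a i + c i, \<lambda>l. b l + d l + hall_form k m a c l)"
  "(a, b) \<up>\<^bsub>hall_model k m\<^esub> \<alpha> = (\<lambda>i. \<alpha> * a i, \<lambda>l. \<alpha> * b l + rbinom \<alpha> 2 * hall_form k m a a l)"
  by (simp_all add: hall_model_def)

lemma group_hall_model: "group (hall_model k m)"
proof (rule groupI)
  fix x :: "(nat \<Rightarrow> 'a) \<times> (nat \<Rightarrow> 'a)"
  obtain a b where x: "x = (a, b)" by (cases x)
  have "(\<lambda>i. - a i, \<lambda>l. - b l + hall_form k m a a l) \<otimes>\<^bsub>hall_model k m\<^esub> x = \<one>\<^bsub>hall_model k m\<^esub>"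
    by (simp add: x hall_model_simps hall_form_linear)
  then show "\<exists>y \<in> carrier (hall_model k m). y \<otimes>\<^bsub>hall_model k m\<^esub> x = \<one>\<^bsub>hall_model k m\<^esub>"
    by (auto simp: hall_model_simps)
qed (auto simp: hall_model_simps hall_form_linear algebra_simps)

lemma hall_model_inv:
  "inv\<^bsub>hall_model k m\<^esub> (a, b) = (\<lambda>i. - a i, \<lambda>l. - b l + hall_form k m a a l)"
  by (rule group.inv_equality[OF group_hall_model])
    (simp_all add: hall_model_simps hall_form_linear)

lemma hall_model_commutator:
  "commutator (hall_model k m) (a, b) (c, d)
     = (\<lambda>i. 0, \<lambda>l. hall_form k m a c l - hall_form k m c a l)"
  by (rule group.commutator_unique[OF group_hall_model])
    (simp_all add: hall_model_simps hall_form_linear algebra_simps)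

lemma H2_hall_model:
  assumes R: "binomial_domain TYPE('r :: {idom, ring_char_0})"
  shows "H2 (hall_model k m :: (_, 'r) rgroup)"
proof -
  let ?M = "hall_model k m :: (_, 'r) rgroup"
  interpret M: group ?M by (rule group_hall_model)
  note bin = rbinom_0[OF R] rbinom_1[OF R] rbinom_add[OF R] rbinom_mult[OF R]
  have sq: "\<alpha> * \<alpha> = \<alpha> + 2 * rbinom \<alpha> 2" for \<alpha> :: 'r
    by (simp add: two_rbinom[OF R] algebra_simps)
  have hall: "(x \<otimes>\<^bsub>?M\<^esub> y) \<up>\<^bsub>?M\<^esub> \<alpha>
      = x \<up>\<^bsub>?M\<^esub> \<alpha> \<otimes>\<^bsub>?M\<^esub> y \<up>\<^bsub>?M\<^esub> \<alpha> \<otimes>\<^bsub>?M\<^esub> commutator ?M x y \<up>\<^bsub>?M\<^esub> (- rbinom \<alpha> 2)" for x y \<alpha>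
  proof -
    obtain a b c d where xy: "x = (a, b)" "y = (c, d)" by (cases x, cases y)
    \<comment> \<open>Comparing v-coordinates in Hall's formula leaves exactly this identity, with f
      the form evaluated on the u-coordinates of x and y.\<close>
    have square: "\<alpha> * (\<alpha> * f) = \<alpha> * f + 2 * (rbinom \<alpha> 2 * f)" for f
      using sq[of \<alpha>] by algebra
    show ?thesis
      by (simp add: xy hall_model_simps hall_model_commutator hall_form_linear fun_eq_iff
          algebra_simps square)
  qed
  have "r_group ?M"
  proof (intro r_group.intro r_group_axioms.intro)
    fix x y :: "(nat \<Rightarrow> 'r) \<times> (nat \<Rightarrow> 'r)" and \<alpha> \<beta> :: 'r
    obtain a b c d where xy: "x = (a, b)" "y = (c, d)" by (cases x, cases y)
    show "x \<up>\<^bsub>?M\<^esub> 1 = x" "x \<up>\<^bsub>?M\<^esub> 0 = \<one>\<^bsub>?M\<^esub>" "\<one>\<^bsub>?M\<^esub> \<up>\<^bsub>?M\<^esub> \<alpha> = \<one>\<^bsub>?M\<^esub>"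
      by (simp_all add: xy hall_model_simps bin hall_form_linear)
    show "x \<up>\<^bsub>?M\<^esub> \<alpha> \<otimes>\<^bsub>?M\<^esub> x \<up>\<^bsub>?M\<^esub> \<beta> = x \<up>\<^bsub>?M\<^esub> (\<alpha> + \<beta>)"
      by (simp add: xy hall_model_simps bin hall_form_linear algebra_simps)
    show "(x \<up>\<^bsub>?M\<^esub> \<alpha>) \<up>\<^bsub>?M\<^esub> \<beta> = x \<up>\<^bsub>?M\<^esub> (\<alpha> * \<beta>)"
      by (simp add: xy hall_model_simps bin hall_form_linear algebra_simps)
    show "(inv\<^bsub>?M\<^esub> y \<otimes>\<^bsub>?M\<^esub> x \<otimes>\<^bsub>?M\<^esub> y) \<up>\<^bsub>?M\<^esub> \<alpha> = inv\<^bsub>?M\<^esub> y \<otimes>\<^bsub>?M\<^esub> x \<up>\<^bsub>?M\<^esub> \<alpha> \<otimes>\<^bsub>?M\<^esub> y"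
      by (simp add: xy hall_model_simps hall_model_inv hall_form_linear algebra_simps)
    assume c: "commutator ?M x y = \<one>\<^bsub>?M\<^esub>"
    have "\<one>\<^bsub>?M\<^esub> \<up>\<^bsub>?M\<^esub> \<alpha> = \<one>\<^bsub>?M\<^esub>" for \<alpha>
      by (simp add: hall_model_simps hall_form_linear)
    \<comment> \<open>For commuting x and y the correction in Hall's formula is a power of \<one>,
      so axiom (4) is a special case.\<close>
    then show "(x \<otimes>\<^bsub>?M\<^esub> y) \<up>\<^bsub>?M\<^esub> \<alpha> = x \<up>\<^bsub>?M\<^esub> \<alpha> \<otimes>\<^bsub>?M\<^esub> y \<up>\<^bsub>?M\<^esub> \<alpha>"
      unfolding hall c by (simp add: hall_model_simps(1))
  qed (simp_all add: M.group_axioms hall_model_simps(1))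
  \<comment> \<open>A commutator has zero u-coordinates, and the form vanishes on these.\<close>
  moreover have "two_nilpotent ?M"
    unfolding two_nilpotent_def
    by (auto simp: hall_model_commutator hall_form_linear hall_model_simps(2))
  ultimately show ?thesis
    unfolding H2_def N2_def using hall by blast
qed

section \<open>Integer coordinates of the discrete group\<close>

text \<open>Ordinary integer powers turn the discrete group into an instance of the same locales as
  its completions, without changing carrier or multiplication.\<close>

definition int_rgroup :: "('a, 'b) monoid_scheme \<Rightarrow> ('a, int) rgroup" where
  "int_rgroup G =
     \<lparr> carrier = carrier G, monoid.mult = monoid.mult G, one = \<one>\<^bsub>G\<^esub>, rpow = (\<lambda>x k. x [^]\<^bsub>G\<^esub> k) \<rparr>"

lemma int_rgroup_simps [simp]:
  "carrier (int_rgroup G) = carrier G"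
  "x \<otimes>\<^bsub>int_rgroup G\<^esub> y = x \<otimes>\<^bsub>G\<^esub> y"
  "\<one>\<^bsub>int_rgroup G\<^esub> = \<one>\<^bsub>G\<^esub>"
  "x \<up>\<^bsub>int_rgroup G\<^esub> k = x [^]\<^bsub>G\<^esub> k"
  by (simp_all add: int_rgroup_def)

lemma int_rgroup_inv [simp]: "inv\<^bsub>int_rgroup G\<^esub> x = inv\<^bsub>G\<^esub> x"
  by (simp add: m_inv_def)

lemma int_rgroup_commutator [simp]: "commutator (int_rgroup G) x y = commutator G x y"
  by (simp add: commutator_def)

lemma int_rgroup_ordered_prod [simp]: "ordered_prod (int_rgroup G) x m = ordered_prod G x m"
  by (induction m) simp_all

lemma int_rgroup_center [simp]: "center (int_rgroup G) = center G"
  by (simp add: center_def)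

lemma (in group) nil2_int_rgroup:
  assumes "two_nilpotent G"
  shows "nil2_rgroup (int_rgroup G)"
proof (intro nil2_rgroup.intro r_group.intro r_group_axioms.intro nil2_rgroup_axioms.intro)
  show "group (int_rgroup G)"
    by (rule groupI) (use l_inv_ex in \<open>auto simp: m_assoc\<close>)
  show "two_nilpotent (int_rgroup G)" using assms by (simp add: two_nilpotent_def)
  fix x y :: 'a and \<alpha> :: int
  show "(inv\<^bsub>int_rgroup G\<^esub> y \<otimes>\<^bsub>int_rgroup G\<^esub> x \<otimes>\<^bsub>int_rgroup G\<^esub> y) \<up>\<^bsub>int_rgroup G\<^esub> \<alpha>
      = inv\<^bsub>int_rgroup G\<^esub> y \<otimes>\<^bsub>int_rgroup G\<^esub> x \<up>\<^bsub>int_rgroup G\<^esub> \<alpha> \<otimes>\<^bsub>int_rgroup G\<^esub> y"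
    if "x \<in> carrier (int_rgroup G)" and y: "y \<in> carrier (int_rgroup G)"
  proof -
    have "inv y \<otimes> (a \<otimes> b) \<otimes> y = inv y \<otimes> a \<otimes> y \<otimes> (inv y \<otimes> b \<otimes> y)"
      if "a \<in> carrier G" "b \<in> carrier G" for a b
    proof -
      have "inv y \<otimes> a \<otimes> y \<otimes> (inv y \<otimes> b \<otimes> y) = inv y \<otimes> a \<otimes> (y \<otimes> inv y) \<otimes> b \<otimes> y"
        using that y by (simp only: m_assoc m_closed inv_closed int_rgroup_simps)
      then show ?thesis using that y by (simp add: m_assoc)
    qed
    then have "(\<lambda>a. inv y \<otimes> a \<otimes> y) \<in> hom G G" using y by (auto simp: hom_def)
    from hom_int_pow[OF this, of x \<alpha>] show ?thesis using that group_axioms by simp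
  qed
  show "(x \<otimes>\<^bsub>int_rgroup G\<^esub> y) \<up>\<^bsub>int_rgroup G\<^esub> \<alpha>
      = x \<up>\<^bsub>int_rgroup G\<^esub> \<alpha> \<otimes>\<^bsub>int_rgroup G\<^esub> y \<up>\<^bsub>int_rgroup G\<^esub> \<alpha>"
    if "x \<in> carrier (int_rgroup G)" "y \<in> carrier (int_rgroup G)"
      "commutator (int_rgroup G) x y = \<one>\<^bsub>int_rgroup G\<^esub>"
    using that commutator_eq_one_iff[of x y] int_pow_mult_distrib[of x y \<alpha>] by simp
qed (simp_all add: int_pow_mult int_pow_pow)

text \<open>Adds existence and uniqueness of integer coordinates. The support condition on
  \<open>k\<close> is needed because \<open>hall_model\<close> has v-coordinates beyond n, where
  \<open>coords\<close> is 0.\<close>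

locale hall_basis = hall_frame G m u n v k
  for G :: "('a, int) rgroup" (structure) and m u n v k +
  assumes k_support: "n \<le> l \<Longrightarrow> k i j l = 0"
    and uv_exhaust: "x \<in> carrier G \<Longrightarrow> \<exists>a b. x = uv a b"
    and uv_eq_one: "uv a b = \<one> \<Longrightarrow> (\<forall>i<m. a i = 0) \<and> (\<forall>l<n. b l = 0)"
begin

lemma uv_inject:
  assumes eq: "uv a b = uv a' b'"
  shows "(\<forall>i<m. a i = a' i) \<and> (\<forall>l<n. b l = b' l)"
proof -
  let ?a = "\<lambda>i. a i - a' i"
  \<comment> \<open>Coordinates of the right quotient of the two elements; the subtracted form
    cancels the one that \<open>uv_mult\<close> adds.\<close>
  let ?b = "\<lambda>l. b l - b' l - hall_form k m ?a a' l"
  have "uv ?a ?b \<otimes> uv a' b' = uv a' b'"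
    by (simp add: uv_mult eq uv_closed)
  then have "uv ?a ?b = \<one>" by (simp add: uv_closed)
  then have a: "\<forall>i<m. ?a i = 0" and b: "\<forall>l<n. ?b l = 0" using uv_eq_one by blast+
  have "hall_form k m ?a a' l = 0" for l using a by (simp add: hall_form_def)
  then show ?thesis using a b by simp
qed

text \<open>A normal form sees only exponents below m and n. Cutting off the chosen exponents makes
  the result independent of the choice, as \<open>coords_uv\<close> confirms.\<close>

definition coords :: "'a \<Rightarrow> (nat \<Rightarrow> 'r :: {idom, ring_char_0}) \<times> (nat \<Rightarrow> 'r)" where
  "coords x = (let (a, b) = (SOME (a, b). x = uv a b) in
     (\<lambda>i. if i < m then of_int (a i) else 0, \<lambda>l. if l < n then of_int (b l) else 0))"

lemma coords_uv:
  "coords (uv a b)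
     = (\<lambda>i. if i < m then of_int (a i) else 0, \<lambda>l. if l < n then of_int (b l) else 0)"
proof -
  obtain a' b' where ab': "(SOME (c, d). uv a b = uv c d) = (a', b')" by fastforce
  have "case (SOME (c, d). uv a b = uv c d) of (c, d) \<Rightarrow> uv a b = uv c d"
    by (rule someI[of _ "(a, b)"]) simp
  then have "uv a b = uv a' b'" by (simp add: ab')
  then have "\<forall>i<m. a i = a' i" "\<forall>l<n. b l = b' l" using uv_inject by blast+
  then show ?thesis by (auto simp: coords_def ab' fun_eq_iff)
qed

lemma coords_hom: "coords \<in> hom G (hall_model k m :: (_, 'r :: {idom, ring_char_0}) rgroup)"
  unfolding hom_def
proof (intro CollectI conjI ballI)
  fix x y assume "x \<in> carrier G" "y \<in> carrier G"
  then obtain a b c d where xy: "x = uv a b" "y = uv c d" using uv_exhaust by meson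
  have "hall_form k m (\<lambda>i. if i < m then of_int (a i) else 0) (\<lambda>i. if i < m then of_int (c i) else 0) l
      = (if l < n then of_int (hall_form k m a c l) else 0 :: 'r)" for l
    by (auto simp: hall_form_def k_support intro!: sum.cong)
  then show "(coords (x \<otimes> y) :: _ \<times> (nat \<Rightarrow> 'r)) = coords x \<otimes>\<^bsub>hall_model k m\<^esub> coords y"
    by (auto simp: xy uv_mult coords_uv hall_model_simps fun_eq_iff)
qed (simp add: hall_model_simps)

section \<open>The frame carried over to an R-group generated by an image of the discrete
  group\<close>

context
  fixes P :: "('p, 'r :: {idom, ring_char_0}) rgroup" and \<iota> :: "'a \<Rightarrow> 'p"
  assumes P: "N2 P" and \<iota>: "\<iota> \<in> hom G P"
    and gen: "r_generate P (\<iota> ` carrier G) = carrier P"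
begin

interpretation P: nil2_rgroup P
  using P by (simp add: N2_def nil2_rgroup_def nil2_rgroup_axioms_def)

interpretation \<iota>: group_hom G P \<iota>
  by (simp add: group_hom_def group_hom_axioms_def \<iota> P.group_axioms group_axioms)

lemma hom_commutator:
  "x \<in> carrier G \<Longrightarrow> y \<in> carrier G \<Longrightarrow> \<iota> (commutator G x y) = commutator P (\<iota> x) (\<iota> y)"
  by (simp add: commutator_def)

lemma hom_rpow:
  assumes "x \<in> carrier G"
  shows "\<iota> (x \<up> z) = \<iota> x \<up>\<^bsub>P\<^esub> of_int z"
  using assms rpow_of_int[of x z] by (simp add: P.rpow_of_int \<iota>.hom_int_pow)

text \<open>Although \<open>\<iota>\<close> need not be onto, its image R-generates
  \<open>P\<close>, so commuting with the image suffices by \<open>centralI\<close>.\<close>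

lemma hom_center:
  assumes z: "z \<in> center G"
  shows "\<iota> z \<in> center P"
proof (rule P.centralI[OF gen])
  show "\<iota> ` carrier G \<subseteq> carrier P" by auto
  fix s assume "s \<in> \<iota> ` carrier G"
  then obtain g where g: "s = \<iota> g" "g \<in> carrier G" by blast
  then have "commutator P (\<iota> z) s = \<iota> (commutator G z g)"
    using z by (simp add: hom_commutator center_closed)
  also have "commutator G z g = \<one>" using z g by (simp add: center_iff_commutator)
  finally show "commutator P (\<iota> z) s = \<one>\<^bsub>P\<^esub>" by simp
qed (simp add: z center_closed)

lemma hall_frame_image: "hall_frame P m (\<lambda>i. \<iota> (u i)) n (\<lambda>j. \<iota> (v j)) k"
proof (unfold_locales)
  fix i j assume ij: "j < i" "i < m"
  then have "commutator P (\<iota> (u i)) (\<iota> (u j)) = \<iota> (commutator G (u i) (u j))"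
    by (simp add: hom_commutator u_closed)
  also have "\<dots> = ordered_prod P (\<lambda>l. \<iota> (v l \<up> of_int (k i j l))) n"
    unfolding u_commutator[OF ij]
    by (rule \<iota>.hom_ordered_prod) (simp add: rpow_closed center_closed v_central)
  also have "\<dots> = ordered_prod P (\<lambda>l. \<iota> (v l) \<up>\<^bsub>P\<^esub> of_int (k i j l)) n"
    by (rule ordered_prod_cong) (simp add: hom_rpow center_closed v_central)
  finally show "commutator P (\<iota> (u i)) (\<iota> (u j))
      = ordered_prod P (\<lambda>l. \<iota> (v l) \<up>\<^bsub>P\<^esub> of_int (k i j l)) n" .
qed (simp_all add: u_closed v_central hom_center)

lemma image_subset_uv_products:
  "\<iota> ` carrier G \<subseteq> uv_products P m (\<lambda>i. \<iota> (u i)) n (\<lambda>j. \<iota> (v j))"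
proof
  interpret F: hall_frame P m "\<lambda>i. \<iota> (u i)" n "\<lambda>j. \<iota> (v j)" k by (rule hall_frame_image)
  fix x assume "x \<in> \<iota> ` carrier G"
  then obtain a b where ab: "x = \<iota> (uv a b)" using uv_exhaust by blast
  have "\<iota> (upart a m) = ordered_prod P (\<lambda>i. \<iota> (u i \<up> a i)) m"
    unfolding upart_def by (rule \<iota>.hom_ordered_prod) (simp add: rpow_closed u_closed)
  also have "\<dots> = F.upart (\<lambda>i. of_int (a i)) m"
    unfolding F.upart_def by (rule ordered_prod_cong) (simp add: hom_rpow u_closed)
  finally have upart: "\<iota> (upart a m) = F.upart (\<lambda>i. of_int (a i)) m" .
  have "\<iota> (vpart b) = ordered_prod P (\<lambda>i. \<iota> (v i \<up> b i)) n"
    unfolding vpart_def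
    by (rule \<iota>.hom_ordered_prod) (simp add: rpow_closed center_closed v_central)
  also have "\<dots> = F.vpart (\<lambda>l. of_int (b l))"
    unfolding F.vpart_def
    by (rule ordered_prod_cong) (simp add: hom_rpow center_closed v_central)
  finally have "x = F.uv (\<lambda>i. of_int (a i)) (\<lambda>l. of_int (b l))"
    unfolding ab uv_def F.uv_def by (simp add: upart upart_closed vpart_closed)
  then show "x \<in> uv_products P m (\<lambda>i. \<iota> (u i)) n (\<lambda>j. \<iota> (v j))"
    by (simp add: F.uv_in_uv_products)
qed

end

end

text \<open>The u-exponents of an element are read off modulo the center, and what remains is
  central and has v-exponents. The constants are the v-exponents of the commutators of the
  u_i.\<close>

lemma (in group) hall_basis_exists:
  assumes nil: "two_nilpotent G"
    and u: "\<And>i. i < m \<Longrightarrow> u i \<in> carrier G"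
      "abelian_basis (G Mod center G) m (\<lambda>i. center G #> u i)"
    and v: "abelian_basis (G\<lparr>carrier := center G\<rparr>) n v"
  shows "\<exists>k. hall_basis (int_rgroup G) m u n v k"
proof -
  let ?Z = "G\<lparr>carrier := center G\<rparr>" and ?Q = "G Mod center G"
  let ?U = "\<lambda>a :: nat \<Rightarrow> int. ordered_prod G (\<lambda>i. u i [^] a i) m"
  let ?V = "\<lambda>b :: nat \<Rightarrow> int. ordered_prod G (\<lambda>j. v j [^] b j) n"
  interpret I: nil2_rgroup "int_rgroup G" by (rule nil2_int_rgroup[OF nil])
  interpret Z: comm_group ?Z using v by (simp add: abelian_basis_def)
  interpret Q: comm_group ?Q using u(2) by (simp add: abelian_basis_def)
  interpret N: normal "center G" G by (rule normal_center)
  interpret \<pi>: group_hom G ?Q "\<lambda>x. center G #> x"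
    by (simp add: group_hom_def group_hom_axioms_def N.r_coset_hom_Mod Q.group_axioms group_axioms)
  have v_central: "v j \<in> center G" if "j < n" for j
    using v that by (simp add: abelian_basis_def)
  have Uclosed: "?U a \<in> carrier G" for a by (rule ordered_prod_closed) (simp add: u(1))
  have Zpow: "z [^]\<^bsub>?Z\<^esub> (i :: int) = z [^] i" if "z \<in> center G" for z i
    by (rule int_pow_consistent[OF subgroup_center that, symmetric])
  have Zprod: "ordered_prod ?Z x t = ordered_prod G x t" for x t
    by (induction t) simp_all
  have V: "(\<Otimes>\<^bsub>?Z\<^esub>j \<in> {..<n}. v j [^]\<^bsub>?Z\<^esub> b j) = ?V b" for b :: "nat \<Rightarrow> int"
  proof -
    have "(\<Otimes>\<^bsub>?Z\<^esub>j \<in> {..<n}. v j [^]\<^bsub>?Z\<^esub> b j) = ordered_prod ?Z (\<lambda>j. v j [^]\<^bsub>?Z\<^esub> b j) n"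
      by (rule Z.finprod_eq_ordered_prod, rule Z.int_pow_closed) (simp add: v_central)
    also have "\<dots> = ?V b"
      unfolding Zprod by (rule ordered_prod_cong) (simp add: Zpow v_central)
    finally show ?thesis .
  qed
  have U: "(\<Otimes>\<^bsub>?Q\<^esub>i \<in> {..<m}. (center G #> u i) [^]\<^bsub>?Q\<^esub> a i) = center G #> ?U a"
    for a :: "nat \<Rightarrow> int"
  proof -
    have "(\<Otimes>\<^bsub>?Q\<^esub>i \<in> {..<m}. (center G #> u i) [^]\<^bsub>?Q\<^esub> a i)
        = ordered_prod ?Q (\<lambda>i. (center G #> u i) [^]\<^bsub>?Q\<^esub> a i) m"
      by (rule Q.finprod_eq_ordered_prod, rule Q.int_pow_closed, rule \<pi>.hom_closed) (rule u(1))
    also have "\<dots> = ordered_prod ?Q (\<lambda>i. center G #> (u i [^] a i)) m"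
      by (rule ordered_prod_cong, rule \<pi>.hom_int_pow[symmetric]) (rule u(1))
    also have "\<dots> = center G #> ?U a"
      by (rule \<pi>.hom_ordered_prod[symmetric]) (simp add: u(1))
    finally show ?thesis .
  qed
  have V_exhaust: "\<exists>b. z = ?V b" if "z \<in> center G" for z
    using v that unfolding abelian_basis_def V by simp
  have V_one: "\<forall>j<n. b j = 0" if "?V b = \<one>" for b
    using v that unfolding abelian_basis_def V by simp
  have U_exhaust: "\<exists>a. center G #> x = center G #> ?U a" if "x \<in> carrier G" for x
    using u(2) \<pi>.hom_closed[OF that] unfolding abelian_basis_def U by blast
  have U_one: "\<forall>i<m. a i = 0" if "center G #> ?U a = center G" for a
    using u(2) that unfolding abelian_basis_def U by simp
  have "\<forall>i j. \<exists>b. i < m \<longrightarrow> j < m \<longrightarrow> commutator G (u i) (u j) = ?V b"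
    using V_exhaust I.commutator_central u(1) by simp
  then obtain k where
    k: "i < m \<Longrightarrow> j < m \<Longrightarrow> commutator G (u i) (u j) = ?V (k i j)" for i j
    by metis
  \<comment> \<open>Cutting off at n secures the support condition and does not affect the products
    over j < n.\<close>
  define k' where "k' i j l = (if l < n then k i j l else 0)" for i j l
  have k': "?V (k' i j) = ?V (k i j)" for i j
    by (rule ordered_prod_cong) (simp add: k'_def)
  interpret F: hall_frame "int_rgroup G" m u n v k'
    by unfold_locales (simp_all add: u(1) v_central k k')
  have uv: "F.uv a b = ?U a \<otimes> ?V b" for a b
    by (simp add: F.uv_def F.upart_def F.vpart_def)
  have "hall_basis (int_rgroup G) m u n v k'"
  proof unfold_locales
    show "k' i j l = 0" if "n \<le> l" for i j l using that by (simp add: k'_def)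
    fix x assume "x \<in> carrier (int_rgroup G)"
    then have x: "x \<in> carrier G" by simp
    obtain a where a: "center G #> x = center G #> ?U a" using U_exhaust[OF x] by blast
    have "x \<in> center G #> ?U a" unfolding a[symmetric] by (rule rcos_self[OF x subgroup_center])
    then obtain z where z: "z \<in> center G" "x = z \<otimes> ?U a" by (auto simp: r_coset_def)
    obtain b where "z = ?V b" using V_exhaust[OF z(1)] by blast
    then have "x = F.uv a b" using z Uclosed by (simp add: uv center_commute)
    then show "\<exists>a b. x = F.uv a b" by blast
  next
    fix a b assume "F.uv a b = \<one>\<^bsub>int_rgroup G\<^esub>"
    then have one: "?U a \<otimes> ?V b = \<one>" by (simp add: uv)
    have Vc: "?V b \<in> center G"
      using F.vpart_central[of b] by (simp add: F.vpart_def)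
    have "?U a = inv (?V b)"
      by (rule inv_equality[symmetric]) (simp_all add: one Uclosed center_closed[OF Vc])
    \<comment> \<open>A central u-part has trivial image in the quotient, so its exponents vanish by
      independence there; the v-exponents follow by independence in the center.\<close>
    then have "?U a \<in> center G" using Vc by (simp add: subgroup.m_inv_closed[OF subgroup_center])
    then have a: "\<forall>i<m. a i = 0"
      by (intro U_one coset_join2 subgroup_center Uclosed)
    have "?U a = ordered_prod G (\<lambda>i. \<one>) m"
      by (rule ordered_prod_cong) (simp add: a)
    then have "?V b = \<one>" using one center_closed[OF Vc] by (simp add: ordered_prod_one)
    then show "(\<forall>i<m. a i = 0) \<and> (\<forall>l<n. b l = 0)" using a V_one by blast
  qed
  then show ?thesis by blast
qed

text \<open>\<open>\<psi>\<close> reads the exponents off a normal form. It is an argument because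
  the universal property concerns the group as a plain monoid record, while \<open>G\<close> here
  carries integer powers.\<close>

lemma (in hall_basis) hall_completion_uv_inject:
  fixes Q :: "('q, 'r :: {idom, ring_char_0}) rgroup"
  assumes R: "binomial_domain TYPE('r)" and H2: "H2 Q" and \<kappa>: "\<kappa> \<in> hom G Q"
    and gen: "r_generate Q (\<kappa> ` carrier G) = carrier Q"
    and \<psi>: "\<psi> \<in> r_hom Q (hall_model k m)" "\<And>g. g \<in> carrier G \<Longrightarrow> coords g = \<psi> (\<kappa> g)"
    and eq: "hall_frame.uv Q m (\<lambda>i. \<kappa> (u i)) n (\<lambda>j. \<kappa> (v j)) a b
      = hall_frame.uv Q m (\<lambda>i. \<kappa> (u i)) n (\<lambda>j. \<kappa> (v j)) a' b'"
  shows "(\<forall>i<m. a i = a' i) \<and> (\<forall>l<n. b l = b' l)"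
proof -
  let ?M = "hall_model k m :: (_, 'r) rgroup"
  have N2: "N2 Q" using H2 by (simp add: H2_def)
  interpret F: hall_frame Q m "\<lambda>i. \<kappa> (u i)" n "\<lambda>j. \<kappa> (v j)" k
    by (rule hall_frame_image[OF N2 \<kappa> gen])
  interpret M: group ?M by (rule group_hall_model)
  interpret \<psi>: group_hom Q ?M \<psi>
    using \<psi>(1) by (simp add: group_hom_def group_hom_axioms_def r_hom_def F.group_axioms M.group_axioms)
  have \<psi>_rpow: "\<psi> (x \<up>\<^bsub>Q\<^esub> \<alpha>) = \<psi> x \<up>\<^bsub>?M\<^esub> \<alpha>" if "x \<in> carrier Q" for x \<alpha>
    using \<psi>(1) that by (simp add: r_hom_def)
  have \<psi>u: "\<psi> (\<kappa> (u i) \<up>\<^bsub>Q\<^esub> \<alpha>) = (\<lambda>j. if j = i then \<alpha> else 0, \<lambda>l. 0)" if i: "i < m" for i \<alpha>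
  proof -
    have "u i = uv (\<lambda>j. if j = i then 1 else 0) (\<lambda>l. 0)"
      using u_rpow_eq_uv[OF i, of 1] by (simp only: rpow_1 u_closed i)
    then have "\<psi> (\<kappa> (u i)) = (\<lambda>j. if j = i then 1 else 0, \<lambda>l. 0)"
      using i by (subst \<psi>(2)[symmetric]) (auto simp: uv_closed coords_uv fun_eq_iff)
    \<comment> \<open>A unit vector has no pair of nonzero entries with j < i, so the binomial
      correction to its powers vanishes.\<close>
    moreover have "hall_form k m (\<lambda>j. if j = i then 1 else 0) (\<lambda>j. if j = i then 1 else 0) l = (0 :: 'r)" for l
      by (auto simp: hall_form_def intro!: sum.neutral)
    ultimately show ?thesis
      using i by (auto simp: \<psi>_rpow F.u_closed hall_model_simps fun_eq_iff)
  qed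
  have \<psi>v: "\<psi> (\<kappa> (v i) \<up>\<^bsub>Q\<^esub> \<alpha>) = (\<lambda>j. 0, \<lambda>l. if l = i then \<alpha> else 0)" if i: "i < n" for i \<alpha>
  proof -
    have "v i = uv (\<lambda>j. 0) (\<lambda>l. if l = i then 1 else 0)"
      using v_rpow_eq_uv[OF i, of 1] by (simp only: rpow_1 center_closed v_central i)
    then have "\<psi> (\<kappa> (v i)) = (\<lambda>j. 0, \<lambda>l. if l = i then 1 else 0)"
      using i by (subst \<psi>(2)[symmetric]) (auto simp: uv_closed coords_uv fun_eq_iff)
    then show ?thesis
      using i by (auto simp: \<psi>_rpow F.center_closed F.v_central hall_model_simps hall_form_linear fun_eq_iff)
  qed
  have u_prod: "ordered_prod ?M (\<lambda>i. (\<lambda>j. if j = i then a i else 0, \<lambda>l. 0)) t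
      = (\<lambda>i. if i < t then a i else 0, \<lambda>l. 0)" for a :: "nat \<Rightarrow> 'r" and t
  proof (induction t)
    case (Suc t)
    \<comment> \<open>The left factor is supported below t and the right one at t, whereas the form
      needs the larger index on the left.\<close>
    have "hall_form k m (\<lambda>i. if i < t then a i else 0) (\<lambda>j. if j = t then a t else 0) l = 0" for l
      by (auto simp: hall_form_def intro!: sum.neutral)
    then show ?case by (auto simp: Suc hall_model_simps fun_eq_iff)
  qed (simp add: hall_model_simps)
  have v_prod: "ordered_prod ?M (\<lambda>i. (\<lambda>j. 0, \<lambda>l. if l = i then b i else 0)) t
      = (\<lambda>i. 0, \<lambda>l. if l < t then b l else 0)" for b :: "nat \<Rightarrow> 'r" and t
    by (induction t) (auto simp: hall_model_simps hall_form_linear fun_eq_iff)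
  have coords: "\<psi> (F.uv a b) = (\<lambda>i. if i < m then a i else 0, \<lambda>l. if l < n then b l else 0)" for a b
  proof -
    have "\<psi> (F.upart a m) = ordered_prod ?M (\<lambda>i. \<psi> (\<kappa> (u i) \<up>\<^bsub>Q\<^esub> a i)) m"
      unfolding F.upart_def by (rule \<psi>.hom_ordered_prod) (simp add: F.rpow_closed F.u_closed)
    also have "\<dots> = ordered_prod ?M (\<lambda>i. (\<lambda>j. if j = i then a i else 0, \<lambda>l. 0)) m"
      by (rule ordered_prod_cong) (rule \<psi>u)
    finally have 1: "\<psi> (F.upart a m) = (\<lambda>i. if i < m then a i else 0, \<lambda>l. 0)"
      unfolding u_prod .
    have "\<psi> (F.vpart b) = ordered_prod ?M (\<lambda>i. \<psi> (\<kappa> (v i) \<up>\<^bsub>Q\<^esub> b i)) n"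
      unfolding F.vpart_def
      by (rule \<psi>.hom_ordered_prod) (simp add: F.rpow_closed F.center_closed F.v_central)
    also have "\<dots> = ordered_prod ?M (\<lambda>i. (\<lambda>j. 0, \<lambda>l. if l = i then b i else 0)) n"
      by (rule ordered_prod_cong) (rule \<psi>v)
    finally have 2: "\<psi> (F.vpart b) = (\<lambda>i. 0, \<lambda>l. if l < n then b l else 0)"
      unfolding v_prod .
    have "\<psi> (F.uv a b) = \<psi> (F.upart a m) \<otimes>\<^bsub>?M\<^esub> \<psi> (F.vpart b)"
      unfolding F.uv_def by (rule \<psi>.hom_mult) (simp_all add: F.upart_closed F.vpart_closed)
    then show ?thesis unfolding 1 2 by (simp add: hall_model_simps hall_form_linear)
  qed
  have "\<psi> (F.uv a b) = \<psi> (F.uv a' b')" using eq by simp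
  then show ?thesis unfolding coords by (auto simp: fun_eq_iff) (metis, metis)
qed

section \<open>The canonical epimorphism\<close>

text \<open>Hall's power formula is the expansion in \<open>rpow_mult_c_commutator\<close> without
  its last factor, so this factor cancels.\<close>

lemma H2_c_commutator:
  assumes Q: "H2 Q" and g: "g \<in> carrier Q" and h: "h \<in> carrier Q"
  shows "c_commutator Q g h \<alpha> = \<one>\<^bsub>Q\<^esub>"
proof -
  interpret nil2_rgroup Q
    using Q by (simp add: H2_def N2_def nil2_rgroup_def nil2_rgroup_axioms_def)
  let ?w = "g \<up>\<^bsub>Q\<^esub> \<alpha> \<otimes>\<^bsub>Q\<^esub> h \<up>\<^bsub>Q\<^esub> \<alpha> \<otimes>\<^bsub>Q\<^esub> commutator Q g h \<up>\<^bsub>Q\<^esub> (- rbinom \<alpha> 2)"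
  have "?w \<otimes>\<^bsub>Q\<^esub> c_commutator Q g h \<alpha> = (g \<otimes>\<^bsub>Q\<^esub> h) \<up>\<^bsub>Q\<^esub> \<alpha>"
    by (rule rpow_mult_c_commutator[OF g h, symmetric])
  also have "\<dots> = ?w" using Q g h by (simp add: H2_def)
  finally show ?thesis
    using g h center_closed[OF c_commutator_central[OF g h]] by (simp add: rpow_closed)
qed

lemma r_hom_c_commutator:
  assumes P: "r_group P" and Q: "r_group Q" and \<mu>: "\<mu> \<in> r_hom P Q"
    and g: "g \<in> carrier P" and h: "h \<in> carrier P"
  shows "\<mu> (c_commutator P g h \<alpha>) = c_commutator Q (\<mu> g) (\<mu> h) \<alpha>"
proof -
  interpret P: r_group P by (rule P)
  interpret Q: r_group Q by (rule Q)
  interpret \<mu>: group_hom P Q \<mu>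
    using \<mu> by (simp add: group_hom_def group_hom_axioms_def r_hom_def P.group_axioms Q.group_axioms)
  show ?thesis
    using \<mu> g h by (simp add: c_commutator_def commutator_def r_hom_def P.rpow_closed)
qed

theorem theorem4p1:
  fixes G :: "'g monoid"
    and P :: "('p, 'r :: {idom, ring_char_0}) rgroup" and \<iota> :: "'g \<Rightarrow> 'p"
    and Q :: "('q, 'r) rgroup" and \<kappa> :: "'g \<Rightarrow> 'q"
    and \<mu> :: "'p \<Rightarrow> 'q"
    and m n :: nat and u v :: "nat \<Rightarrow> 'g"
  assumes R: "binomial_domain TYPE('r)"
    and G: "group G" "finitely_generated G" "two_nilpotent G" "torsion_free G"
    and P: "tensor_completion G P \<iota>"
    and Q: "hall_completion G Q \<kappa>"
    and \<mu>: "\<mu> \<in> r_hom P Q" "\<And>g. g \<in> carrier G \<Longrightarrow> \<mu> (\<iota> g) = \<kappa> g"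
    and u: "\<And>i. i < m \<Longrightarrow> u i \<in> carrier G"
      "abelian_basis (G Mod center G) m (\<lambda>i. center G #>\<^bsub>G\<^esub> u i)"
    and v: "abelian_basis (G\<lparr>carrier := center G\<rparr>) n v"
  shows
    "let H = uv_products P m (\<lambda>i. \<iota> (u i)) n (\<lambda>j. \<iota> (v j));
         D = kernel P Q \<mu>
     in subgroup H P \<and>
        \<comment> \<open>1)\<close>
        \<mu> \<in> iso (P\<lparr>carrier := H\<rparr>) Q \<and>
        (\<exists>\<sigma> \<in> mon Q P. \<sigma> ` carrier Q = H \<and>
           (\<forall>q \<in> carrier Q. \<mu> (\<sigma> q) = q) \<and> (\<forall>x \<in> H. \<sigma> (\<mu> x) = x)) \<and>
        \<comment> \<open>2)\<close>
        r_subgroup D P \<and> comm_group (P\<lparr>carrier := D\<rparr>) \<and>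
        D = r_generate P {c_commutator P g h \<alpha> | g h \<alpha>. g \<in> carrier P \<and> h \<in> carrier P} \<and>
        \<comment> \<open>3)\<close>
        P \<cong> Q \<times>\<times> P\<lparr>carrier := D\<rparr>"
proof -
  interpret G: group G by (rule G(1))
  obtain k where k: "hall_basis (int_rgroup G) m u n v k"
    using G.hall_basis_exists[OF G(3) u v] by blast
  interpret I: hall_basis "int_rgroup G" m u n v k by (rule k)
  let ?\<iota>u = "\<lambda>i. \<iota> (u i)" and ?\<iota>v = "\<lambda>j. \<iota> (v j)" and ?\<kappa>u = "\<lambda>i. \<kappa> (u i)" and ?\<kappa>v = "\<lambda>j. \<kappa> (v j)"
  have P_N2: "N2 P" and P_hom: "\<iota> \<in> hom (int_rgroup G) P"
    and P_gen: "r_generate P (\<iota> ` carrier (int_rgroup G)) = carrier P"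
    using P by (simp_all add: tensor_completion_def hom_def)
  have Q_H2: "H2 Q" and Q_hom: "\<kappa> \<in> hom (int_rgroup G) Q"
    and Q_gen: "r_generate Q (\<kappa> ` carrier (int_rgroup G)) = carrier Q"
    using Q by (simp_all add: hall_completion_def hom_def)
  have Q_N2: "N2 Q" using Q_H2 by (simp add: H2_def)
  interpret P: hall_frame P m ?\<iota>u n ?\<iota>v k by (rule I.hall_frame_image[OF P_N2 P_hom P_gen])
  interpret Q: hall_frame Q m ?\<kappa>u n ?\<kappa>v k by (rule I.hall_frame_image[OF Q_N2 Q_hom Q_gen])
  note P_sub = I.image_subset_uv_products[OF P_N2 P_hom P_gen]
  note Q_sub = I.image_subset_uv_products[OF Q_N2 Q_hom Q_gen]
  interpret \<mu>: group_hom P Q \<mu>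
    using \<mu>(1) by (simp add: group_hom_def group_hom_axioms_def r_hom_def P.group_axioms Q.group_axioms)
  have \<mu>_rpow: "\<mu> (x \<up>\<^bsub>P\<^esub> \<alpha>) = \<mu> x \<up>\<^bsub>Q\<^esub> \<alpha>" if "x \<in> carrier P" for x \<alpha>
    using \<mu>(1) that by (simp add: r_hom_def)
  have \<mu>_uv: "\<mu> (P.uv a b) = Q.uv a b" for a b
  proof -
    have "\<mu> (P.upart a m) = ordered_prod Q (\<lambda>i. \<mu> (\<iota> (u i) \<up>\<^bsub>P\<^esub> a i)) m"
      unfolding P.upart_def by (rule \<mu>.hom_ordered_prod) (simp add: P.rpow_closed P.u_closed)
    also have "\<dots> = Q.upart a m"
      unfolding Q.upart_def by (rule ordered_prod_cong) (simp add: \<mu>_rpow P.u_closed \<mu>(2) u(1))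
    finally have 1: "\<mu> (P.upart a m) = Q.upart a m" .
    have "\<mu> (P.vpart b) = ordered_prod Q (\<lambda>i. \<mu> (\<iota> (v i) \<up>\<^bsub>P\<^esub> b i)) n"
      unfolding P.vpart_def
      by (rule \<mu>.hom_ordered_prod) (simp add: P.rpow_closed P.center_closed P.v_central)
    also have "\<dots> = Q.vpart b"
      unfolding Q.vpart_def
      using I.v_central I.center_closed
      by (intro ordered_prod_cong) (simp add: \<mu>_rpow P.center_closed P.v_central \<mu>(2))
    finally have 2: "\<mu> (P.vpart b) = Q.vpart b" .
    show ?thesis
      unfolding P.uv_def Q.uv_def by (simp add: 1 2 P.upart_closed P.vpart_closed)
  qed

  define H where "H = uv_products P m ?\<iota>u n ?\<iota>v"
  define D where "D = kernel P Q \<mu>"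
  let ?CP = "{c_commutator P g h \<alpha> | g h \<alpha>. g \<in> carrier P \<and> h \<in> carrier P}"
  let ?CQ = "{c_commutator Q g h \<alpha> | g h \<alpha>. g \<in> carrier Q \<and> h \<in> carrier Q}"
  have H: "subgroup H P" unfolding H_def by (rule P.subgroup_uv_products)
  have Hcl: "x \<in> carrier P" if "x \<in> H" for x using H that by (rule subgroup.mem_carrier)

  have "I.coords \<in> hom G (hall_model k m :: (_, 'r) rgroup)"
    using I.coords_hom by (simp add: hom_def)
  then obtain \<psi> where \<psi>: "\<psi> \<in> r_hom Q (hall_model k m :: (_, 'r) rgroup)"
    "\<And>g. g \<in> carrier G \<Longrightarrow> I.coords g = \<psi> (\<kappa> g)"
    using hall_completion_universal[OF Q H2_hall_model[OF R]] by blast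
  have inj: "inj_on \<mu> H"
  proof (rule inj_onI)
    fix x y assume "x \<in> H" "y \<in> H" and eq: "\<mu> x = \<mu> y"
    then obtain a b a' b' where xy: "x = P.uv a b" "y = P.uv a' b'"
      unfolding H_def by (metis P.uv_productsE)
    have "Q.uv a b = Q.uv a' b'" using eq by (simp add: xy \<mu>_uv)
    then have "(\<forall>i<m. a i = a' i) \<and> (\<forall>l<n. b l = b' l)"
      by (intro I.hall_completion_uv_inject[OF R Q_H2 Q_hom Q_gen \<psi>(1)]) (simp_all add: \<psi>(2))
    then show "x = y" unfolding xy by (intro P.uv_cong) auto
  qed
  \<comment> \<open>With trivial c-commutators the decomposition in \<open>Q\<close> loses its
    second factor, so normal forms exhaust \<open>Q\<close>.\<close>
  have "r_generate Q ?CQ \<subseteq> {\<one>\<^bsub>Q\<^esub>}"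
  proof (rule Q.r_generate_minimal)
    show "r_subgroup {\<one>\<^bsub>Q\<^esub>} Q"
      by (simp add: r_subgroup_def Q.triv_subgroup Q.one_rpow)
  qed (auto simp: H2_c_commutator[OF Q_H2])
  then have Q_eq: "carrier Q \<subseteq> uv_products Q m ?\<kappa>u n ?\<kappa>v"
    using Q.uv_products_mult_c_commutators[OF Q_sub Q_gen] Q.uv_closed
    by (fastforce elim!: Q.uv_productsE simp: Q.uv_in_uv_products)
  have surj: "\<mu> ` H = carrier Q"
  proof
    show "\<mu> ` H \<subseteq> carrier Q" using Hcl by auto
    show "carrier Q \<subseteq> \<mu> ` H"
    proof
      fix q assume "q \<in> carrier Q"
      then obtain a b where "q = Q.uv a b" using Q_eq by (blast elim: Q.uv_productsE)
      then have "q = \<mu> (P.uv a b)" by (simp add: \<mu>_uv)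
      then show "q \<in> \<mu> ` H" unfolding H_def using P.uv_in_uv_products by blast
    qed
  qed

  define \<sigma> where "\<sigma> = inv_into H \<mu>"
  have \<mu>\<sigma>: "\<mu> (\<sigma> q) = q" and \<sigma>H: "\<sigma> q \<in> H" if "q \<in> carrier Q" for q
    using that unfolding \<sigma>_def surj[symmetric] by (simp_all add: f_inv_into_f inv_into_into)
  have \<sigma>\<mu>: "\<sigma> (\<mu> x) = x" if "x \<in> H" for x
    unfolding \<sigma>_def by (rule inv_into_f_f[OF inj that])
  \<comment> \<open>The product of \<open>\<sigma> q\<close> and \<open>\<sigma> r\<close> stays in
    \<open>H\<close> and \<open>\<mu>\<close> maps it to the product of q and r; applying
    \<open>\<sigma>\<close> returns it.\<close>
  have \<sigma>_mult: "\<sigma> (q \<otimes>\<^bsub>Q\<^esub> r) = \<sigma> q \<otimes>\<^bsub>P\<^esub> \<sigma> r" if "q \<in> carrier Q" "r \<in> carrier Q" for q r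
    using \<sigma>\<mu>[OF subgroup.m_closed[OF H \<sigma>H[OF that(1)] \<sigma>H[OF that(2)]]] that
    by (simp add: Hcl \<sigma>H \<mu>\<sigma>)
  have iso: "\<mu> \<in> iso (P\<lparr>carrier := H\<rparr>) Q"
    unfolding iso_def bij_betw_def hom_def using inj surj Hcl by auto
  have "inj_on \<sigma> (carrier Q)" by (rule inj_on_inverseI[of _ \<mu>], rule \<mu>\<sigma>)
  then have "\<sigma> \<in> mon Q P"
    unfolding mon_def hom_def using \<sigma>_mult \<sigma>H Hcl by auto
  moreover have "\<sigma> ` carrier Q = H"
  proof
    show "\<sigma> ` carrier Q \<subseteq> H" using \<sigma>H by blast
    show "H \<subseteq> \<sigma> ` carrier Q"
    proof
      fix x assume x: "x \<in> H"
      show "x \<in> \<sigma> ` carrier Q"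
        by (rule image_eqI[of _ _ "\<mu> x"]) (simp_all add: \<sigma>\<mu> x Hcl)
    qed
  qed
  ultimately have splitting: "\<exists>\<sigma> \<in> mon Q P. \<sigma> ` carrier Q = H \<and>
      (\<forall>q \<in> carrier Q. \<mu> (\<sigma> q) = q) \<and> (\<forall>x \<in> H. \<sigma> (\<mu> x) = x)"
    using \<mu>\<sigma> \<sigma>\<mu> by blast

  have D: "subgroup D P" unfolding D_def by (rule \<mu>.subgroup_kernel)
  have D_r: "r_subgroup D P"
    unfolding r_subgroup_def using D
    by (auto simp: D_def kernel_def P.rpow_closed \<mu>_rpow Q.one_rpow)
  have "?CP \<subseteq> D"
    using P.center_closed[OF P.c_commutator_central]
      r_hom_c_commutator[OF P.r_group_axioms Q.r_group_axioms \<mu>(1)] H2_c_commutator[OF Q_H2]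
    by (auto simp: D_def kernel_def)
  then have CD: "r_generate P ?CP \<subseteq> D" by (rule P.r_generate_minimal[OF D_r])
  have decomp: "\<exists>y \<in> H. \<exists>c \<in> r_generate P ?CP. x = y \<otimes>\<^bsub>P\<^esub> c" if "x \<in> carrier P" for x
    unfolding H_def by (rule P.uv_products_mult_c_commutators[OF P_sub P_gen that])
  have "D \<subseteq> r_generate P ?CP"
  proof
    fix x assume x: "x \<in> D"
    then obtain y c where yc: "y \<in> H" "c \<in> r_generate P ?CP" "x = y \<otimes>\<^bsub>P\<^esub> c"
      using decomp subgroup.mem_carrier[OF D] by meson
    have "\<mu> y = \<one>\<^bsub>Q\<^esub>"
      using x yc CD Hcl by (auto simp: D_def kernel_def)
    then have "\<mu> y = \<mu> \<one>\<^bsub>P\<^esub>" by simp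
    then have "y = \<one>\<^bsub>P\<^esub>" by (rule inj_onD[OF inj _ yc(1) subgroup.one_closed[OF H]])
    then show "x \<in> r_generate P ?CP"
      using yc CD subgroup.mem_carrier[OF D] by auto
  qed
  with CD have D_eq: "D = r_generate P ?CP" by blast
  have D_central: "D \<subseteq> center P"
    unfolding D_eq
    by (rule P.r_generate_minimal[OF P.r_subgroup_center]) (auto intro: P.c_commutator_central)
  have D_comm: "comm_group (P\<lparr>carrier := D\<rparr>)"
    by (rule group.group_comm_groupI[OF subgroup.subgroup_is_group[OF D P.group_axioms]])
      (use D_central subgroup.mem_carrier[OF D] in \<open>auto intro: P.center_commute\<close>)

  let ?f = "\<lambda>(q, d). \<sigma> q \<otimes>\<^bsub>P\<^esub> d"
  have Dcl: "d \<in> carrier P" and \<mu>D: "\<mu> d = \<one>\<^bsub>Q\<^esub>" if "d \<in> D" for d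
    using that by (auto simp: D_def kernel_def)
  \<comment> \<open>Recovering q from the product gives injectivity of \<open>?f\<close>: once the
    first components agree, the second ones agree by cancellation.\<close>
  have \<mu>f: "\<mu> (\<sigma> q \<otimes>\<^bsub>P\<^esub> d) = q" if "q \<in> carrier Q" "d \<in> D" for q d
    using that by (simp add: Hcl \<sigma>H Dcl \<mu>D \<mu>\<sigma>)
  have "?f \<in> iso (Q \<times>\<times> P\<lparr>carrier := D\<rparr>) P"
  proof (rule isoI)
    have "\<sigma> (q \<otimes>\<^bsub>Q\<^esub> r) \<otimes>\<^bsub>P\<^esub> (c \<otimes>\<^bsub>P\<^esub> d) = (\<sigma> q \<otimes>\<^bsub>P\<^esub> c) \<otimes>\<^bsub>P\<^esub> (\<sigma> r \<otimes>\<^bsub>P\<^esub> d)"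
      if "q \<in> carrier Q" "r \<in> carrier Q" "c \<in> D" "d \<in> D" for q r c d
      using that D_central
      by (subst P.central_interchange) (auto simp: \<sigma>_mult Hcl \<sigma>H Dcl)
    then show "?f \<in> hom (Q \<times>\<times> P\<lparr>carrier := D\<rparr>) P"
      by (auto simp: hom_def Hcl \<sigma>H Dcl)
    have "inj_on ?f (carrier Q \<times> D)"
    proof (rule inj_onI, clarify)
      fix q c r d
      assume *: "q \<in> carrier Q" "c \<in> D" "r \<in> carrier Q" "d \<in> D"
        and eq: "\<sigma> q \<otimes>\<^bsub>P\<^esub> c = \<sigma> r \<otimes>\<^bsub>P\<^esub> d"
      then have "q = r" using \<mu>f by metis
      then show "q = r \<and> c = d" using * eq by (simp add: Hcl \<sigma>H Dcl)
    qed
    moreover have "?f ` (carrier Q \<times> D) = carrier P"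
    proof
      show "?f ` (carrier Q \<times> D) \<subseteq> carrier P" by (auto simp: Hcl \<sigma>H Dcl)
      show "carrier P \<subseteq> ?f ` (carrier Q \<times> D)"
      proof
        fix x assume "x \<in> carrier P"
        then obtain y c where yc: "y \<in> H" "c \<in> D" "x = y \<otimes>\<^bsub>P\<^esub> c"
          using decomp unfolding D_eq by meson
        then have "x = ?f (\<mu> y, c)" by (simp add: \<sigma>\<mu>)
        moreover have "(\<mu> y, c) \<in> carrier Q \<times> D" using yc Hcl by simp
        ultimately show "x \<in> ?f ` (carrier Q \<times> D)" by (rule image_eqI)
      qed
    qed
    ultimately show "bij_betw ?f (carrier (Q \<times>\<times> P\<lparr>carrier := D\<rparr>)) (carrier P)"
      by (simp add: bij_betw_def)
  qed
  then have "P \<cong> Q \<times>\<times> P\<lparr>carrier := D\<rparr>"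
    by (rule group.iso_sym[OF DirProd_group[OF Q.group_axioms
          subgroup.subgroup_is_group[OF D P.group_axioms]] is_isoI])
  then show ?thesis
    unfolding Let_def H_def[symmetric] D_def[symmetric]
    using H iso splitting D_r D_comm D_eq by blast
qed

end
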